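(* Let $\Delta\colon\mathcal C([n])\to\mathcal C([n])$ be a shifting operation and let $\Gamma\in\mathcal C([n])$ be a $(d-1)$-dimensional simplicial complex. Then $$\mathrm{adeg}_i\,\Gamma\le\mathrm{adeg}_i\,\Delta(\Gamma)\quad\text{for } i=0,\dots,d.$$ In particular, $|\mathrm{facets}(\Gamma)|\le|\mathrm{facets}(\Delta(\Gamma))|$.
   Context: A simplicial complex on $[n]=\{1,\dots,n\}$ is a set $\Gamma$ of subsets of $[n]$ (faces) closed under taking subsets; $\mathcal C([n])$ is the set of all of them. A face with $d+1$ elements has dimension $d$ (the empty face has dimension $-1$), $\dim\Gamma$ is the maximal dimension of a face, $\mathrm{facets}(\Gamma)$ is the set of inclusion-maximal faces, and $f(\Gamma)=(f_{-1},\dots,f_{\dim\Gamma})$ is the vector of numbers of faces of each dimension. A shifting operation is a map $\Delta\colon\mathcal C([n])\to\mathcal C([n])$ such that: (S1) for all $\Gamma$, $\Delta(\Gamma)$ is shifted, i.e. for all $F\in\Delta(\Gamma)$, $i\in F$ and $j>i$ one has $(F\setminus\{i\})\cup\{j\}\in\Delta(\Gamma)$; (S2) if $\Gamma$ is shifted then $\Delta(\Gamma)=\Gamma$; (S3) $f(\Gamma)=f(\Delta(\Gamma))$ for all $\Gamma$; (S4) if $\Gamma'\subseteq\Gamma$ then $\Delta(\Gamma')\subseteq\Delta(\Gamma)$. $\mathrm{adeg}_i\,\Gamma=\mathrm{adeg}_i\,K[\Gamma]=\sum_{\mathfrak p} \ell\bigl(H^0_{\mathfrak p}(K[\Gamma]_{\mathfrak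 p})\bigr)\deg(K[\Gamma]/\mathfrak p)$, where $\mathfrak p$ runs over the associated primes of the Stanley--Reisner ring $K[\Gamma]$ ($K$ a field) with $\dim K[\Gamma]/\mathfrak p=i$, $\ell$ is length and $\deg$ is multiplicity; combinatorially, $\mathrm{adeg}_i\,\Gamma=|\{F\in\mathrm{facets}(\Gamma):\dim F=i-1\}|$. *)

theory Defs
  imports
    "HOL-Algebra.QuotRing"
    "HOL-Algebra.Ideal_Product"
    "HOL-Algebra.Embedded_Algebras"
    "HOL-Computational_Algebra.Polynomial"
    "HOL-Library.Poly_Mapping"
    "HOL-Library.Extended_Nat"
begin

section \<open>Simplicial complexes and shifting operations\<close>

definition simplicial_complexes :: "nat \<Rightarrow> nat set set set" where
  "simplicial_complexes n = {\<Gamma>. \<Gamma> \<subseteq> Pow {1..n} \<and> (\<forall>F\<in>\<Gamma>. \<forall>G. G \<subseteq> F \<longrightarrow> G \<in> \<Gamma>)}"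

definition face_dim :: "nat set \<Rightarrow> int" where
  "face_dim F = int (card F) - 1"

text \<open>The void complex (without any face, not even the empty one) belongs to
  \<^term>\<open>simplicial_complexes n\<close>.  Its dimension is set to \<open>-2\<close>, so that its f-vector is empty;
  every other complex has dimension at least \<open>-1\<close>.\<close>

definition complex_dim :: "nat set set \<Rightarrow> int" where
  "complex_dim \<Gamma> = (if \<Gamma> = {} then -2 else Max (face_dim ` \<Gamma>))"

definition facets :: "nat set set \<Rightarrow> nat set set" where
  "facets \<Gamma> = {F \<in> \<Gamma>. \<forall>G\<in>\<Gamma>. F \<subseteq> G \<longrightarrow> G = F}"

definition f_vector :: "nat set set \<Rightarrow> nat list" where
  "f_vector \<Gamma> = map (\<lambda>k. card {F \<in> \<Gamma>. face_dim F = k}) [-1..complex_dim \<Gamma>]"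

definition shifted :: "nat \<Rightarrow> nat set set \<Rightarrow> bool" where
  "shifted n \<Gamma> \<longleftrightarrow>
     (\<forall>F\<in>\<Gamma>. \<forall>i\<in>F. \<forall>j\<in>{1..n}. i < j \<longrightarrow> insert j (F - {i}) \<in> \<Gamma>)"

definition shifting_operation :: "nat \<Rightarrow> (nat set set \<Rightarrow> nat set set) \<Rightarrow> bool" where
  "shifting_operation n \<Delta> \<longleftrightarrow>
     (\<forall>\<Gamma>\<in>simplicial_complexes n. \<Delta> \<Gamma> \<in> simplicial_complexes n) \<and>
     (\<forall>\<Gamma>\<in>simplicial_complexes n. shifted n (\<Delta> \<Gamma>)) \<and>
     (\<forall>\<Gamma>\<in>simplicial_complexes n. shifted n \<Gamma> \<longrightarrow> \<Delta> \<Gamma> = \<Gamma>) \<and>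
     (\<forall>\<Gamma>\<in>simplicial_complexes n. f_vector \<Gamma> = f_vector (\<Delta> \<Gamma>)) \<and>
     (\<forall>\<Gamma>\<in>simplicial_complexes n. \<forall>\<Gamma>'\<in>simplicial_complexes n. \<Gamma>' \<subseteq> \<Gamma> \<longrightarrow> \<Delta> \<Gamma>' \<subseteq> \<Delta> \<Gamma>)"


section \<open>Commutative algebra\<close>

definition associated_primes :: "('a, 'm) ring_scheme \<Rightarrow> 'a set set" where
  "associated_primes R =
     {P. primeideal P R \<and>
         (\<exists>x\<in>carrier R. P = {r \<in> carrier R. r \<otimes>\<^bsub>R\<^esub> x = \<zero>\<^bsub>R\<^esub>})}"

definition krull_dim :: "('a, 'm) ring_scheme \<Rightarrow> enat" where
  "krull_dim R = (SUP r \<in> {r. \<exists>C :: nat \<Rightarrow> 'a set.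
       (\<forall>i\<le>r. primeideal (C i) R) \<and> (\<forall>i<r. C i \<subset> C (Suc i))}. enat r)"

text \<open>The length of an ideal \<open>J\<close> of a commutative ring \<open>R\<close> as an \<open>R\<close>-module: its submodules are
  the ideals of \<open>R\<close> that are contained in \<open>J\<close>.\<close>

definition ideal_length :: "('a, 'm) ring_scheme \<Rightarrow> 'a set \<Rightarrow> enat" where
  "ideal_length R J = (SUP r \<in> {r. \<exists>C :: nat \<Rightarrow> 'a set.
       (\<forall>i\<le>r. ideal (C i) R \<and> C i \<subseteq> J) \<and> (\<forall>i<r. C i \<subset> C (Suc i))}. enat r)"

primrec ideal_power :: "('a, 'm) ring_scheme \<Rightarrow> 'a set \<Rightarrow> nat \<Rightarrow> 'a set" where
  "ideal_power R J 0 = carrier R"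
| "ideal_power R J (Suc k) = J \<cdot>\<^bsub>R\<^esub> ideal_power R J k"

definition local_cohomology_0 :: "('a, 'm) ring_scheme \<Rightarrow> 'a set \<Rightarrow> 'a set" where
  "local_cohomology_0 R J =
     {x \<in> carrier R. \<exists>k. \<forall>y\<in>ideal_power R J k. y \<otimes>\<^bsub>R\<^esub> x = \<zero>\<^bsub>R\<^esub>}"

text \<open>Localization of \<open>R\<close> at a prime ideal \<open>P\<close>; the fraction \<open>a / s\<close> is the class of the
  pair \<open>(a, s)\<close>.\<close>

definition frac_rel :: "('a, 'm) ring_scheme \<Rightarrow> 'a set \<Rightarrow> (('a \<times> 'a) \<times> ('a \<times> 'a)) set" where
  "frac_rel R P =
     {((a, s), (b, t)) | a s b t.
        a \<in> carrier R \<and> b \<in> carrier R \<and> s \<in> carrier R - P \<and> t \<in> carrier R - P \<and>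
        (\<exists>u\<in>carrier R - P. u \<otimes>\<^bsub>R\<^esub> (a \<otimes>\<^bsub>R\<^esub> t \<ominus>\<^bsub>R\<^esub> b \<otimes>\<^bsub>R\<^esub> s) = \<zero>\<^bsub>R\<^esub>)}"

definition fraction :: "('a, 'm) ring_scheme \<Rightarrow> 'a set \<Rightarrow> 'a \<Rightarrow> 'a \<Rightarrow> ('a \<times> 'a) set" where
  "fraction R P a s = frac_rel R P `` {(a, s)}"

definition localization :: "('a, 'm) ring_scheme \<Rightarrow> 'a set \<Rightarrow> ('a \<times> 'a) set ring" where
  "localization R P =
     \<lparr>carrier = (carrier R \<times> (carrier R - P)) // frac_rel R P,
      monoid.mult = (\<lambda>X Y. \<Union>(a, s)\<in>X. \<Union>(b, t)\<in>Y. fraction R P (a \<otimes>\<^bsub>R\<^esub> b) (s \<otimes>\<^bsub>R\<^esub> t)),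
      one = fraction R P \<one>\<^bsub>R\<^esub> \<one>\<^bsub>R\<^esub>,
      zero = fraction R P \<zero>\<^bsub>R\<^esub> \<one>\<^bsub>R\<^esub>,
      add = (\<lambda>X Y. \<Union>(a, s)\<in>X. \<Union>(b, t)\<in>Y.
               fraction R P (a \<otimes>\<^bsub>R\<^esub> t \<oplus>\<^bsub>R\<^esub> b \<otimes>\<^bsub>R\<^esub> s) (s \<otimes>\<^bsub>R\<^esub> t))\<rparr>"

definition localized_prime :: "('a, 'm) ring_scheme \<Rightarrow> 'a set \<Rightarrow> ('a \<times> 'a) set set" where
  "localized_prime R P = {fraction R P a s | a s. a \<in> P \<and> s \<in> carrier R - P}"

text \<open>In the following, a standard graded algebra is given by a ring \<open>A\<close>, the coefficient field
  \<open>K \<subseteq> carrier A\<close>, and the graded components \<open>G t \<subseteq> carrier A\<close>.\<close>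

definition hilbert_polynomial ::
    "('a, 'm) ring_scheme \<Rightarrow> 'a set \<Rightarrow> (nat \<Rightarrow> 'a set) \<Rightarrow> rat poly" where
  "hilbert_polynomial A K G =
     (THE p. \<forall>\<^sub>F t in sequentially. of_nat (ring.dim A K (G t)) = poly p (of_nat t))"

definition graded_multiplicity ::
    "('a, 'm) ring_scheme \<Rightarrow> 'a set \<Rightarrow> (nat \<Rightarrow> 'a set) \<Rightarrow> rat" where
  "graded_multiplicity A K G =
     (if krull_dim A = 0 then of_nat (the_enat (ideal_length A (carrier A)))
      else fact (the_enat (krull_dim A) - 1) * lead_coeff (hilbert_polynomial A K G))"

text \<open>Both the set of associated primes and the lengths occurring here are finite when \<open>R\<close> is
  Noetherian.  The ring \<open>R Quot P\<close> carries the coefficient field and the grading induced from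
  \<open>R\<close>; associated primes of a graded ring are homogeneous.\<close>

definition ring_adeg ::
    "('a, 'm) ring_scheme \<Rightarrow> 'a set \<Rightarrow> (nat \<Rightarrow> 'a set) \<Rightarrow> nat \<Rightarrow> rat" where
  "ring_adeg R K G i =
     (\<Sum>P \<in> {P \<in> associated_primes R. krull_dim (R Quot P) = enat i}.
        of_nat (the_enat (ideal_length (localization R P)
          (local_cohomology_0 (localization R P) (localized_prime R P)))) *
        graded_multiplicity (R Quot P)
          ((\<lambda>x. P +>\<^bsub>R\<^esub> x) ` K) (\<lambda>t. (\<lambda>x. P +>\<^bsub>R\<^esub> x) ` G t))"


section \<open>Stanley--Reisner rings\<close>

text \<open>The polynomial ring in the variables \<open>x\<^sub>1, \<dots>, x\<^sub>n\<close> is the subring of the ring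
  of polynomials in variables indexed by \<^typ>\<open>nat\<close> whose monomials involve only these variables.\<close>

definition poly_ring :: "nat \<Rightarrow> ((nat \<Rightarrow>\<^sub>0 nat) \<Rightarrow>\<^sub>0 'k::field) ring" where
  "poly_ring n =
     \<lparr>carrier = {f. \<forall>m\<in>Poly_Mapping.keys f. Poly_Mapping.keys m \<subseteq> {1..n}},
      monoid.mult = (*), one = 1, zero = 0, add = (+)\<rparr>"

definition poly_var :: "nat \<Rightarrow> ((nat \<Rightarrow>\<^sub>0 nat) \<Rightarrow>\<^sub>0 'k::field)" where
  "poly_var j = Poly_Mapping.single (Poly_Mapping.single j 1) 1"

definition poly_constants :: "((nat \<Rightarrow>\<^sub>0 nat) \<Rightarrow>\<^sub>0 'k::field) set" where
  "poly_constants = range (Poly_Mapping.single 0)"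

definition homogeneous_polys :: "nat \<Rightarrow> nat \<Rightarrow> ((nat \<Rightarrow>\<^sub>0 nat) \<Rightarrow>\<^sub>0 'k::field) set" where
  "homogeneous_polys n t =
     {f \<in> carrier (poly_ring n). \<forall>m\<in>Poly_Mapping.keys f.
        (\<Sum>j\<in>Poly_Mapping.keys m. Poly_Mapping.lookup m j) = t}"

definition sr_ideal :: "nat \<Rightarrow> nat set set \<Rightarrow> ((nat \<Rightarrow>\<^sub>0 nat) \<Rightarrow>\<^sub>0 'k::field) set" where
  "sr_ideal n \<Gamma> =
     Idl\<^bsub>poly_ring n\<^esub> {\<Prod>j\<in>F. poly_var j | F. F \<subseteq> {1..n} \<and> F \<notin> \<Gamma>}"

definition sr_ring :: "nat \<Rightarrow> nat set set \<Rightarrow> ((nat \<Rightarrow>\<^sub>0 nat) \<Rightarrow>\<^sub>0 'k::field) set ring" where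
  "sr_ring n \<Gamma> = poly_ring n Quot sr_ideal n \<Gamma>"

definition sr_residue :: "nat \<Rightarrow> nat set set \<Rightarrow>
    ((nat \<Rightarrow>\<^sub>0 nat) \<Rightarrow>\<^sub>0 'k::field) \<Rightarrow> ((nat \<Rightarrow>\<^sub>0 nat) \<Rightarrow>\<^sub>0 'k) set" where
  "sr_residue n \<Gamma> f = sr_ideal n \<Gamma> +>\<^bsub>poly_ring n\<^esub> f"

definition complex_adeg :: "'k::field itself \<Rightarrow> nat \<Rightarrow> nat set set \<Rightarrow> nat \<Rightarrow> rat" where
  "complex_adeg _ n \<Gamma> i =
     ring_adeg (sr_ring n \<Gamma> :: ((nat \<Rightarrow>\<^sub>0 nat) \<Rightarrow>\<^sub>0 'k) set ring)
       (sr_residue n \<Gamma> ` poly_constants)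
       (\<lambda>t. sr_residue n \<Gamma> ` homogeneous_polys n t) i"

end

theory Submission
  imports Defs
    "HOL-Computational_Algebra.Fraction_Field"
    "HOL-Library.Infinite_Set"
begin

text \<open>
  The arithmetic degree \<open>adeg\<^sub>i\<close> of a complex is a sum over its facets in which the contribution of a
  facet depends only on its cardinality.  Indeed, the Stanley--Reisner ring embeds into the product of
  the polynomial rings in the variables of the facets.  So the zero ideal is the intersection of
  the kernels of the projections, one prime for each facet, and the product of the variables of a
  facet \<open>F\<close> lies in all of these primes but the one of \<open>F\<close>.  Hence these are the associated primes,
  and the localizations at them are fields, in which the length of local cohomology is \<open>1\<close>.  The
  residue ring at \<open>F\<close> is a polynomial ring in \<open>card F\<close> variables as a graded ring.  This gives
  \<open>adeg\<^sub>i \<Gamma> = (\<Sum>F\<in>facets \<Gamma>. w\<^sub>i (card F))\<close> in lemma \<open>complex_adeg_eq\<close>, where \<open>w\<^sub>i k\<close> is the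
  multiplicity of the polynomial ring in \<open>k\<close> variables if its Krull dimension is \<open>i\<close>, and \<open>0\<close>
  otherwise.  The weights are nonnegative: they are lengths, or positive multiples of the leading
  coefficient of a Hilbert polynomial, whose values count monomials.

  Both inequalities of the theorem are therefore inequalities of sums over facets with nonnegative
  weights depending on cardinality, and they follow from lemma \<open>card_facets_le_shifting\<close>: for each
  \<open>k\<close>, shifting does not decrease the number of facets with \<open>k\<close> elements.  This is a counting
  argument with the subcomplex generated by the faces with \<open>k + 1\<close> elements; it combines the
  preservation of f-vectors with monotonicity.
\<close>

section \<open>Counting facets\<close>

lemma finite_complex:
  assumes "\<Gamma> \<in> simplicial_complexes n"
  shows "finite \<Gamma>" and "F \<in> \<Gamma> \<Longrightarrow> finite F"
proof -
  have sub: "\<Gamma> \<subseteq> Pow {1..n}"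
    using assms by (auto simp: simplicial_complexes_def)
  show "finite \<Gamma>"
    by (rule finite_subset[OF sub]) simp
  show "finite F" if "F \<in> \<Gamma>"
    using that sub by (meson PowD finite_atLeastAtMost finite_subset subset_eq)
qed

lemma face_subset:
  "\<lbrakk>\<Gamma> \<in> simplicial_complexes n; F \<in> \<Gamma>; G \<subseteq> F\<rbrakk> \<Longrightarrow> G \<in> \<Gamma>"
  by (auto simp: simplicial_complexes_def)

lemma face_dim_le_complex_dim:
  assumes "finite \<Gamma>" "F \<in> \<Gamma>"
  shows "face_dim F \<le> complex_dim \<Gamma>"
  using assms by (auto simp: complex_dim_def)

lemma complex_dim_ge:
  assumes "finite \<Gamma>"
  shows "-2 \<le> complex_dim \<Gamma>"
proof (cases "\<Gamma> = {}")
  case False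
  then obtain F where "F \<in> \<Gamma>" by blast
  then have "face_dim F \<le> complex_dim \<Gamma>"
    using assms by (rule face_dim_le_complex_dim[rotated])
  then show ?thesis by (simp add: face_dim_def)
qed (simp add: complex_dim_def)

text \<open>The length of the f-vector determines the dimension, so that equality of f-vectors compares
  entries of the same dimension; beyond the common dimension both complexes have no faces.\<close>

lemma f_vector_eq_imp_card_faces_eq:
  assumes fin: "finite \<Gamma>" "finite \<Gamma>'" and eq: "f_vector \<Gamma> = f_vector \<Gamma>'"
  shows "card {F \<in> \<Gamma>. card F = k} = card {F \<in> \<Gamma>'. card F = k}"
proof -
  have "length (f_vector \<Gamma>) = length (f_vector \<Gamma>')"
    using eq by simp
  then have dim: "complex_dim \<Gamma> = complex_dim \<Gamma>'"
    using complex_dim_ge[OF fin(1)] complex_dim_ge[OF fin(2)] by (simp add: f_vector_def)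
  have face_dim_iff: "face_dim F = int k - 1 \<longleftrightarrow> card F = k" for F
    by (auto simp: face_dim_def)
  show ?thesis
  proof (cases "int k - 1 \<le> complex_dim \<Gamma>")
    case True
    then have "int k - 1 \<in> set [-1..complex_dim \<Gamma>]" by simp
    then have "card {F \<in> \<Gamma>. face_dim F = int k - 1} = card {F \<in> \<Gamma>'. face_dim F = int k - 1}"
      using eq unfolding f_vector_def dim[symmetric] map_eq_conv by blast
    then show ?thesis unfolding face_dim_iff .
  next
    case False
    then have "face_dim F \<noteq> int k - 1" if "F \<in> \<Gamma> \<or> F \<in> \<Gamma>'" for F
      using that face_dim_le_complex_dim[OF fin(1), of F] face_dim_le_complex_dim[OF fin(2), of F] dim
      by auto
    then have "{F \<in> \<Gamma>. card F = k} = {}" "{F \<in> \<Gamma>'. card F = k} = {}"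
      unfolding face_dim_iff by blast+
    then show ?thesis by (simp only:)
  qed
qed

definition generated_by_faces :: "nat \<Rightarrow> nat set set \<Rightarrow> nat set set" where
  "generated_by_faces k \<Gamma> = {G. \<exists>F\<in>\<Gamma>. card F = k \<and> G \<subseteq> F}"

lemma generated_by_faces_complex:
  assumes "\<Gamma> \<in> simplicial_complexes n"
  shows "generated_by_faces k \<Gamma> \<in> simplicial_complexes n" "generated_by_faces k \<Gamma> \<subseteq> \<Gamma>"
  using assms by (fastforce simp: simplicial_complexes_def generated_by_faces_def)+

lemma faces_of_generated_by_faces:
  assumes "\<Gamma> \<in> simplicial_complexes n"
  shows "{F \<in> generated_by_faces k \<Gamma>. card F = k} = {F \<in> \<Gamma>. card F = k}"
proof -
  have "F \<in> \<Gamma>" if "F \<in> generated_by_faces k \<Gamma>" for F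
    using that generated_by_faces_complex(2)[OF assms] by blast
  then show ?thesis by (auto simp: generated_by_faces_def)
qed

text \<open>A face that is not a facet can be enlarged by a single vertex, because the complex is closed
  under taking subsets.\<close>

lemma facets_of_card:
  assumes \<Gamma>: "\<Gamma> \<in> simplicial_complexes n"
  shows "{F \<in> facets \<Gamma>. card F = k} =
    {F \<in> \<Gamma>. card F = k} - {F \<in> generated_by_faces (Suc k) \<Gamma>. card F = k}"
proof (intro equalityI subsetI)
  fix F assume F: "F \<in> {F \<in> facets \<Gamma>. card F = k}"
  have "F \<notin> generated_by_faces (Suc k) \<Gamma>"
    using F unfolding generated_by_faces_def facets_def by fastforce
  then show "F \<in> {F \<in> \<Gamma>. card F = k} - {F \<in> generated_by_faces (Suc k) \<Gamma>. card F = k}"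
    using F by (auto simp: facets_def)
next
  fix F assume F: "F \<in> {F \<in> \<Gamma>. card F = k} - {F \<in> generated_by_faces (Suc k) \<Gamma>. card F = k}"
  have "H = F" if H: "H \<in> \<Gamma>" "F \<subseteq> H" for H
  proof (rule ccontr)
    assume "H \<noteq> F"
    then obtain x where x: "x \<in> H" "x \<notin> F" using H(2) by blast
    have "insert x F \<in> \<Gamma>"
      using face_subset[OF \<Gamma> H(1)] x(1) H(2) by blast
    moreover have "card (insert x F) = Suc k"
      using F x(2) finite_complex(2)[OF \<Gamma>] by auto
    ultimately have "F \<in> generated_by_faces (Suc k) \<Gamma>"
      unfolding generated_by_faces_def by blast
    then show False using F by blast
  qed
  then show "F \<in> {F \<in> facets \<Gamma>. card F = k}"
    using F by (auto simp: facets_def)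
qed

text \<open>A face with \<open>k\<close> elements is a facet unless it is covered by a face with \<open>k + 1\<close> elements.
  Since \<open>\<Delta>\<close> preserves the number of faces with \<open>k\<close> elements, it suffices that it does not
  increase the number of covered ones.  Let \<open>\<Gamma>'\<close> be generated by the faces of \<open>\<Gamma>\<close> with
  \<open>k + 1\<close> elements.  By monotonicity and by counting, \<open>\<Delta> \<Gamma>'\<close> contains all faces of \<open>\<Delta> \<Gamma>\<close>
  with \<open>k + 1\<close> elements.  Hence it contains every covered face of \<open>\<Delta> \<Gamma>\<close>, and it has as many
  faces with \<open>k\<close> elements as \<open>\<Gamma>'\<close>, where these are exactly the covered faces of \<open>\<Gamma>\<close>.\<close>

lemma card_facets_le_shifting:
  assumes \<Delta>: "shifting_operation n \<Delta>" and \<Gamma>: "\<Gamma> \<in> simplicial_complexes n"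
  shows "card {F \<in> facets \<Gamma>. card F = k} \<le> card {F \<in> facets (\<Delta> \<Gamma>). card F = k}"
proof -
  let ?gen = "generated_by_faces (Suc k)"
  let ?faces = "\<lambda>j \<Theta>. {F \<in> \<Theta>. card F = j} :: nat set set"
  have complex: "\<Delta> \<Theta> \<in> simplicial_complexes n"
    and same_card: "card (?faces j (\<Delta> \<Theta>)) = card (?faces j \<Theta>)"
    if "\<Theta> \<in> simplicial_complexes n" for \<Theta> j
  proof -
    show \<Delta>\<Theta>: "\<Delta> \<Theta> \<in> simplicial_complexes n"
      using \<Delta> that by (simp add: shifting_operation_def)
    have "f_vector (\<Delta> \<Theta>) = f_vector \<Theta>"
      using \<Delta> that unfolding shifting_operation_def by metis
    then show "card (?faces j (\<Delta> \<Theta>)) = card (?faces j \<Theta>)"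
      using finite_complex(1)[OF that] finite_complex(1)[OF \<Delta>\<Theta>]
      by (intro f_vector_eq_imp_card_faces_eq)
  qed
  have card_facets: "card (?faces k (facets \<Theta>)) =
      card (?faces k \<Theta>) - card (?faces k (?gen \<Theta>))"
    if "\<Theta> \<in> simplicial_complexes n" for \<Theta>
    unfolding facets_of_card[OF that]
  proof (rule card_Diff_subset)
    show sub: "?faces k (?gen \<Theta>) \<subseteq> ?faces k \<Theta>"
      using generated_by_faces_complex(2)[OF that] by blast
    show "finite (?faces k (?gen \<Theta>))"
      using finite_complex(1)[OF that] by (intro finite_subset[OF sub]) simp
  qed
  note gen = generated_by_faces_complex[OF \<Gamma>, of "Suc k"]
  have "?faces (Suc k) (\<Delta> (?gen \<Gamma>)) = ?faces (Suc k) (\<Delta> \<Gamma>)"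
  proof (rule card_subset_eq)
    show "finite (?faces (Suc k) (\<Delta> \<Gamma>))"
      using finite_complex(1)[OF complex[OF \<Gamma>]] by simp
    have "\<Delta> (?gen \<Gamma>) \<subseteq> \<Delta> \<Gamma>"
      using \<Delta> \<Gamma> gen unfolding shifting_operation_def by blast
    then show "?faces (Suc k) (\<Delta> (?gen \<Gamma>)) \<subseteq> ?faces (Suc k) (\<Delta> \<Gamma>)" by blast
    show "card (?faces (Suc k) (\<Delta> (?gen \<Gamma>))) = card (?faces (Suc k) (\<Delta> \<Gamma>))"
      by (simp only: same_card[OF \<Gamma>] same_card[OF gen(1)] faces_of_generated_by_faces[OF \<Gamma>])
  qed
  then have "?gen (\<Delta> \<Gamma>) \<subseteq> \<Delta> (?gen \<Gamma>)"
    using face_subset[OF complex[OF gen(1)]] unfolding generated_by_faces_def by blast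
  then have "card (?faces k (?gen (\<Delta> \<Gamma>))) \<le> card (?faces k (\<Delta> (?gen \<Gamma>)))"
    using finite_complex(1)[OF complex[OF gen(1)]] by (intro card_mono) auto
  then show ?thesis
    unfolding card_facets[OF \<Gamma>] card_facets[OF complex[OF \<Gamma>]] same_card[OF \<Gamma>] same_card[OF gen(1)]
    by (rule diff_le_mono2)
qed

lemma sum_over_facets:
  fixes g :: "nat \<Rightarrow> 'a::comm_semiring_1"
  assumes "\<Gamma> \<in> simplicial_complexes n"
  shows "(\<Sum>F\<in>facets \<Gamma>. g (card F)) = (\<Sum>k\<le>n. of_nat (card {F \<in> facets \<Gamma>. card F = k}) * g k)"
proof -
  have fin: "finite (facets \<Gamma>)"
    by (rule finite_subset[OF _ finite_complex(1)[OF assms]]) (auto simp: facets_def)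
  have le: "card F \<le> n" if "F \<in> facets \<Gamma>" for F
  proof -
    have "F \<subseteq> {1..n}" using that assms unfolding facets_def simplicial_complexes_def by blast
    then show ?thesis using card_mono[of "{1..n}" F] by simp
  qed
  have "(\<Sum>F\<in>facets \<Gamma>. g (card F)) = (\<Sum>k\<le>n. \<Sum>F\<in>{F \<in> facets \<Gamma>. card F = k}. g (card F))"
    by (rule sum.group[symmetric, OF fin]) (auto intro: le)
  also have "\<dots> = (\<Sum>k\<le>n. of_nat (card {F \<in> facets \<Gamma>. card F = k}) * g k)"
    by (rule sum.cong) simp_all
  finally show ?thesis .
qed

section \<open>Invariance under ring isomorphisms\<close>

lemma vimage_psubset:
  assumes "C \<subset> D" "D \<subseteq> h ` A"
  shows "{x \<in> A. h x \<in> C} \<subset> {x \<in> A. h x \<in> D}"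
proof -
  obtain y where "y \<in> D" "y \<notin> C" using assms(1) by blast
  moreover then obtain x where "x \<in> A" "y = h x" using assms(2) by blast
  ultimately show ?thesis using assms(1) by blast
qed

text \<open>Preimages of prime ideals are prime, and along a surjection they preserve strict inclusions.\<close>

lemma krull_dim_le_of_surj:
  assumes hom: "ring_hom_ring R S h" and "cring R" and surj: "h ` carrier R = carrier S"
  shows "krull_dim S \<le> krull_dim R"
proof -
  have "enat r \<le> krull_dim R"
    if prime: "\<forall>i\<le>r. primeideal (C i) S" and chain: "\<forall>i<r. C i \<subset> C (Suc i)"
    for r and C :: "nat \<Rightarrow> 'c set"
  proof -
    let ?D = "\<lambda>i. {x \<in> carrier R. h x \<in> C i}"
    have "primeideal (?D i) R" if "i \<le> r" for i
      using ring_hom_ring.primeideal_vimage[OF hom \<open>cring R\<close>] prime that by blast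
    moreover have "?D i \<subset> ?D (Suc i)" if "i < r" for i
    proof (rule vimage_psubset)
      show "C i \<subset> C (Suc i)" using chain that by blast
      show "C (Suc i) \<subseteq> h ` carrier R"
        using prime that ideal.Icarr[OF primeideal.axioms(1)] unfolding surj by (meson Suc_leI subsetI)
    qed
    ultimately show ?thesis
      unfolding krull_dim_def by (intro SUP_upper CollectI exI[of _ ?D]) blast
  qed
  then show ?thesis
    unfolding krull_dim_def[of S] by (intro SUP_least) blast
qed

lemma ideal_length_le_of_surj:
  assumes hom: "ring_hom_ring R S h" and surj: "h ` carrier R = carrier S"
  shows "ideal_length S (carrier S) \<le> ideal_length R (carrier R)"
proof -
  have "enat r \<le> ideal_length R (carrier R)"
    if ideal: "\<forall>i\<le>r. ideal (C i) S \<and> C i \<subseteq> carrier S" and chain: "\<forall>i<r. C i \<subset> C (Suc i)"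
    for r and C :: "nat \<Rightarrow> 'c set"
  proof -
    let ?D = "\<lambda>i. {x \<in> carrier R. h x \<in> C i}"
    have "ideal (?D i) R \<and> ?D i \<subseteq> carrier R" if "i \<le> r" for i
      using ring_hom_ring.ideal_vimage[OF hom] ideal that by blast
    moreover have "?D i \<subset> ?D (Suc i)" if "i < r" for i
    proof (rule vimage_psubset)
      show "C i \<subset> C (Suc i)" using chain that by blast
      show "C (Suc i) \<subseteq> h ` carrier R"
        using ideal that unfolding surj by simp
    qed
    ultimately show ?thesis
      unfolding ideal_length_def by (intro SUP_upper CollectI exI[of _ ?D]) blast
  qed
  then show ?thesis
    unfolding ideal_length_def[of S] by (intro SUP_least) blast
qed

text \<open>Both invariants are compared in the two directions, along the isomorphism and its inverse.\<close>

lemma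
  assumes R: "cring R" and S: "cring S" and h: "h \<in> ring_iso R S"
  shows krull_dim_ring_iso: "krull_dim S = krull_dim R"
    and ideal_length_ring_iso: "ideal_length S (carrier S) = ideal_length R (carrier R)"
proof -
  note rings = cring.axioms(1)[OF R] cring.axioms(1)[OF S]
  have inverse: "inv_into (carrier R) h \<in> ring_iso S R"
    by (rule ring_iso_set_sym[OF rings(1) h])
  have hom: "ring_hom_ring R S h" "ring_hom_ring S R (inv_into (carrier R) h)"
    using h inverse rings by (auto intro: ring_hom_ringI2 simp: ring_iso_def)
  have surj: "h ` carrier R = carrier S" "inv_into (carrier R) h ` carrier S = carrier R"
    using h inverse by (auto simp: ring_iso_def bij_betw_def)
  show "krull_dim S = krull_dim R"
    using krull_dim_le_of_surj[OF hom(1) R surj(1)] krull_dim_le_of_surj[OF hom(2) S surj(2)]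
    by (rule antisym)
  show "ideal_length S (carrier S) = ideal_length R (carrier R)"
    using ideal_length_le_of_surj[OF hom(1) surj(1)] ideal_length_le_of_surj[OF hom(2) surj(2)]
    by (rule antisym)
qed

text \<open>The graded components have to be finite-dimensional, since the value of \<^const>\<open>ring.dim\<close> is
  transported by way of a basis.\<close>

lemma graded_multiplicity_ring_iso:
  assumes R: "cring R" and S: "cring S" and h: "h \<in> ring_iso R S"
    and K: "subfield K R" and nontrivial: "\<one>\<^bsub>S\<^esub> \<noteq> \<zero>\<^bsub>S\<^esub>"
    and G: "\<And>t. G t \<subseteq> carrier R" "\<And>t. \<exists>n. ring.dimension R n K (G t)"
  shows "graded_multiplicity S (h ` K) (\<lambda>t. h ` G t) = graded_multiplicity R K G"
proof -
  interpret ring_hom_ring R S h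
    using R S h by (auto intro!: ring_hom_ringI2 simp: ring_iso_def cring.axioms(1))
  have "S.dim (h ` K) (h ` G t) = R.dim K (G t)" for t
  proof -
    obtain n where n: "R.dimension n K (G t)" using G(2) by blast
    have "inj_on h (G t)"
      using h G(1) by (auto simp: ring_iso_def bij_betw_def intro: inj_on_subset)
    then have "S.dimension n (h ` K) (h ` G t)"
      using inj_hom_dimension[OF K nontrivial _ n] by blast
    then show ?thesis
      using S.dimI[OF img_is_subfield(2)[OF K nontrivial]] R.dimI[OF K n] by (simp add: over_def)
  qed
  then show ?thesis
    by (simp add: graded_multiplicity_def hilbert_polynomial_def
        krull_dim_ring_iso[OF R S h] ideal_length_ring_iso[OF R S h])
qed

section \<open>Localization at an isolated prime\<close>

lemma (in field) ideal_length_field: "ideal_length R (carrier R) = 1"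
proof (rule antisym)
  have "r \<le> 1"
    if ideal: "\<forall>i\<le>r. ideal (C i) R \<and> C i \<subseteq> carrier R" and chain: "\<forall>i<r. C i \<subset> C (Suc i)"
    for r and C :: "nat \<Rightarrow> 'a set"
  proof (rule ccontr)
    assume "\<not> r \<le> 1"
    then have ideals: "ideal (C 0) R" "ideal (C 1) R" "ideal (C 2) R"
      and strict: "C 0 \<subset> C 1" "C 1 \<subset> C 2"
      using ideal chain by (auto simp: numeral_2_eq_2)
    have "I = {\<zero>} \<or> I = carrier R" if "ideal I R" for I
      using all_ideals that by blast
    from ideals[THEN this] strict show False
      by (elim disjE) auto
  qed
  then show "ideal_length R (carrier R) \<le> 1"
    unfolding ideal_length_def one_enat_def by (intro SUP_least) auto
  let ?C = "\<lambda>i::nat. if i = 0 then {\<zero>} else carrier R"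
  have "\<forall>i\<le>1. ideal (?C i) R \<and> ?C i \<subseteq> carrier R"
    using zeroideal oneideal by simp
  moreover have "{\<zero>} \<subset> carrier R"
    using one_closed zero_closed one_not_zero by (metis empty_subsetI insert_subset psubsetI singletonD)
  then have "\<forall>i<1. ?C i \<subset> ?C (Suc i)"
    by simp
  ultimately show "1 \<le> ideal_length R (carrier R)"
    unfolding ideal_length_def one_enat_def by (intro SUP_upper CollectI exI[of _ ?C]) blast
qed

lemma (in field) local_cohomology_0_field: "local_cohomology_0 R {\<zero>} = carrier R"
proof -
  have zero: "y = \<zero>" if "y \<in> {\<zero>} \<cdot>\<^bsub>R\<^esub> carrier R" for y
    using that by (induct y rule: ideal_prod.induct) auto
  then have "\<forall>y\<in>ideal_power R {\<zero>} 1. y \<otimes> x = \<zero>" if "x \<in> carrier R" for x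
    using that by (auto dest: zero)
  then show ?thesis
    unfolding local_cohomology_0_def by blast
qed

text \<open>Transport of the field structure from a subset of a field type that is closed under the field
  operations to a record on an arbitrary carrier.\<close>

lemma field_of_subfield_image:
  fixes L (structure) and Q :: "'c::field set"
  assumes carrier: "carrier L = \<phi> ` Q" and inj: "inj_on \<phi> Q"
    and Q: "0 \<in> Q" "1 \<in> Q" "\<And>x. x \<in> Q \<Longrightarrow> - x \<in> Q" "\<And>x. x \<in> Q \<Longrightarrow> inverse x \<in> Q"
      "\<And>x y. \<lbrakk>x \<in> Q; y \<in> Q\<rbrakk> \<Longrightarrow> x + y \<in> Q" "\<And>x y. \<lbrakk>x \<in> Q; y \<in> Q\<rbrakk> \<Longrightarrow> x * y \<in> Q"
    and hom: "\<zero> = \<phi> 0" "\<one> = \<phi> 1" "\<And>x y. \<lbrakk>x \<in> Q; y \<in> Q\<rbrakk> \<Longrightarrow> \<phi> x \<oplus> \<phi> y = \<phi> (x + y)"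
      "\<And>x y. \<lbrakk>x \<in> Q; y \<in> Q\<rbrakk> \<Longrightarrow> \<phi> x \<otimes> \<phi> y = \<phi> (x * y)"
  shows "field L"
proof -
  have "abelian_group L"
  proof (rule abelian_groupI)
    fix x assume "x \<in> carrier L"
    then obtain a where "a \<in> Q" "x = \<phi> a" unfolding carrier by blast
    then show "\<exists>y\<in>carrier L. y \<oplus> x = \<zero>"
      by (intro bexI[of _ "\<phi> (- a)"]) (simp_all add: carrier hom Q)
  qed (auto simp: carrier hom Q algebra_simps)
  moreover have "comm_monoid L"
    by (rule comm_monoidI) (auto simp: carrier hom Q algebra_simps)
  ultimately interpret cring L
    by (rule cringI) (auto simp: carrier hom Q algebra_simps)
  show ?thesis
  proof (rule cring_fieldI2)
    show "\<zero> \<noteq> \<one>"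
      using inj Q(1,2) zero_neq_one unfolding hom by (metis inj_onD)
    fix x assume "x \<in> carrier L" "x \<noteq> \<zero>"
    then obtain a where "a \<in> Q" "x = \<phi> a" "a \<noteq> 0" unfolding carrier hom by blast
    then show "\<exists>y\<in>carrier L. x \<otimes> y = \<one>"
      by (intro bexI[of _ "\<phi> (inverse a)"]) (simp_all add: carrier hom Q)
  qed
qed

text \<open>A prime ideal is presented as the kernel of a homomorphism into an integral domain.  The
  field of fractions of the domain then serves to compute the localization at this prime.\<close>

locale hom_to_idom = cring R for R :: "('a, 'm) ring_scheme" (structure) +
  fixes \<psi> :: "'a \<Rightarrow> 'k::idom"
  assumes hom_add: "\<lbrakk>x \<in> carrier R; y \<in> carrier R\<rbrakk> \<Longrightarrow> \<psi> (x \<oplus> y) = \<psi> x + \<psi> y"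
    and hom_mult: "\<lbrakk>x \<in> carrier R; y \<in> carrier R\<rbrakk> \<Longrightarrow> \<psi> (x \<otimes> y) = \<psi> x * \<psi> y"
    and hom_one: "\<psi> \<one> = 1"
begin

definition ker :: "'a set" where
  "ker = {x \<in> carrier R. \<psi> x = 0}"

lemma hom_zero: "\<psi> \<zero> = 0"
  using hom_add[OF zero_closed zero_closed] l_zero[OF zero_closed] by (metis add_cancel_right_right)

lemma hom_uminus: "x \<in> carrier R \<Longrightarrow> \<psi> (\<ominus> x) = - \<psi> x"
  using hom_add[of "\<ominus> x" x] by (simp add: l_neg hom_zero eq_neg_iff_add_eq_0)

lemma hom_minus: "\<lbrakk>x \<in> carrier R; y \<in> carrier R\<rbrakk> \<Longrightarrow> \<psi> (x \<ominus> y) = \<psi> x - \<psi> y"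
  by (simp add: a_minus_def hom_add hom_uminus)

lemma primeideal_ker: "primeideal ker R"
proof (rule primeidealI)
  show "ideal ker R"
  proof (rule idealI)
    show "subgroup ker (add_monoid R)"
      by (rule subgroup.intro) (auto simp: ker_def hom_add hom_zero hom_uminus simp flip: a_inv_def)
  qed (auto simp: ker_def hom_mult ring_axioms)
  show "carrier R \<noteq> ker"
    using one_closed hom_one unfolding ker_def by (metis (mono_tags, lifting) mem_Collect_eq zero_neq_one)
qed (auto simp: ker_def hom_mult is_cring)

text \<open>An element \<open>e\<close> outside of the kernel that annihilates the kernel becomes invertible in the
  localization, so that the localized kernel vanishes and the localization is a field: the field of
  fractions of the image of \<open>\<psi>\<close>.\<close>

context
  fixes e
  assumes e: "e \<in> carrier R" "\<psi> e \<noteq> 0" "\<And>r. r \<in> ker \<Longrightarrow> r \<otimes> e = \<zero>"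
begin

definition fractions :: "('a \<times> 'a) set" where
  "fractions = carrier R \<times> (carrier R - ker)"

definition frac_value :: "'a \<times> 'a \<Rightarrow> 'k fract" where
  "frac_value p = Fract (\<psi> (fst p)) (\<psi> (snd p))"

definition frac_class :: "'k fract \<Rightarrow> ('a \<times> 'a) set" where
  "frac_class z = {p \<in> fractions. frac_value p = z}"

text \<open>Two fractions agree in the localization iff they have the same value: \<open>\<psi>\<close> maps a relation
  \<open>u \<otimes> (a \<otimes> t \<ominus> b \<otimes> s) = \<zero>\<close> to the equality of the values because \<open>\<psi> u \<noteq> 0\<close>, and conversely
  \<open>u = e\<close> witnesses every equality of values.\<close>

lemma frac_rel_iff:
  "(p, q) \<in> frac_rel R ker \<longleftrightarrow> p \<in> fractions \<and> q \<in> fractions \<and> frac_value p = frac_value q"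
proof -
  obtain a s b t where pq: "p = (a, s)" "q = (b, t)" by (metis surj_pair)
  show ?thesis
  proof (cases "p \<in> fractions \<and> q \<in> fractions")
    case True
    then have carr: "a \<in> carrier R" "b \<in> carrier R" "s \<in> carrier R" "t \<in> carrier R"
      and nz: "\<psi> s \<noteq> 0" "\<psi> t \<noteq> 0"
      by (auto simp: pq fractions_def ker_def)
    let ?d = "a \<otimes> t \<ominus> b \<otimes> s"
    have d: "?d \<in> carrier R" "\<psi> ?d = \<psi> a * \<psi> t - \<psi> b * \<psi> s"
      using carr by (simp_all add: hom_minus hom_mult)
    have "(\<exists>u\<in>carrier R - ker. u \<otimes> ?d = \<zero>) \<longleftrightarrow> \<psi> ?d = 0"
    proof
      assume "\<exists>u\<in>carrier R - ker. u \<otimes> ?d = \<zero>"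
      then obtain u where "u \<in> carrier R" "\<psi> u \<noteq> 0" "u \<otimes> ?d = \<zero>"
        by (auto simp: ker_def)
      then show "\<psi> ?d = 0"
        using hom_mult[of u ?d] d(1) hom_zero by simp
    next
      assume "\<psi> ?d = 0"
      then have "e \<otimes> ?d = \<zero>"
        using e(3)[of ?d] e(1) d(1) m_comm by (simp add: ker_def)
      then show "\<exists>u\<in>carrier R - ker. u \<otimes> ?d = \<zero>"
        using e(1,2) by (auto simp: ker_def)
    qed
    also have "\<dots> \<longleftrightarrow> frac_value p = frac_value q"
      using nz unfolding d(2) by (simp add: pq frac_value_def eq_fract(1))
    finally show ?thesis
      using True by (auto simp: frac_rel_def pq fractions_def)
  qed (auto simp: frac_rel_def pq fractions_def)
qed

lemma fraction_eq: "(a, s) \<in> fractions \<Longrightarrow> fraction R ker a s = frac_class (frac_value (a, s))"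
  by (auto simp: fraction_def frac_class_def frac_rel_iff)

lemma frac_value_zero: "frac_value (\<zero>, \<one>) = 0" "(\<zero>, \<one>) \<in> fractions"
  by (simp_all add: frac_value_def fractions_def ker_def hom_zero hom_one Zero_fract_def)

lemma frac_value_one: "frac_value (\<one>, \<one>) = 1" "(\<one>, \<one>) \<in> fractions"
  by (simp_all add: frac_value_def fractions_def ker_def hom_one One_fract_def)

lemma frac_value_ops:
  assumes "(a, s) \<in> fractions" "(b, t) \<in> fractions"
  shows "frac_value (a \<otimes> b, s \<otimes> t) = frac_value (a, s) * frac_value (b, t)"
    and "frac_value (a \<otimes> t \<oplus> b \<otimes> s, s \<otimes> t) = frac_value (a, s) + frac_value (b, t)"
    and "(a \<otimes> b, s \<otimes> t) \<in> fractions" and "(a \<otimes> t \<oplus> b \<otimes> s, s \<otimes> t) \<in> fractions"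
  using assms by (auto simp: frac_value_def fractions_def ker_def hom_add hom_mult)

lemma frac_value_uminus:
  assumes "(a, s) \<in> fractions"
  shows "frac_value (\<ominus> a, s) = - frac_value (a, s)" "(\<ominus> a, s) \<in> fractions"
  using assms by (auto simp: frac_value_def fractions_def ker_def hom_uminus)

lemma frac_value_inverse:
  assumes "(a, s) \<in> fractions"
  shows "\<exists>p\<in>fractions. frac_value p = inverse (frac_value (a, s))"
proof (cases "\<psi> a = 0")
  case True
  then have "frac_value (a, s) = 0"
    using assms by (simp add: frac_value_def fractions_def ker_def Zero_fract_def eq_fract)
  then show ?thesis
    using frac_value_zero by force
next
  case False
  then have "(s, a) \<in> fractions" using assms by (auto simp: fractions_def ker_def)
  then show ?thesis
    by (rule bexI[rotated]) (simp add: frac_value_def)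
qed

lemma UN_frac_class:
  assumes "p \<in> fractions" "q \<in> fractions"
    and const: "\<And>a s b t. \<lbrakk>(a, s) \<in> fractions; (b, t) \<in> fractions; frac_value (a, s) = frac_value p;
      frac_value (b, t) = frac_value q\<rbrakk> \<Longrightarrow> g a s b t = X"
  shows "(\<Union>(a, s)\<in>frac_class (frac_value p). \<Union>(b, t)\<in>frac_class (frac_value q). g a s b t) = X"
proof (rule SUP_eq_const)
  show "frac_class (frac_value p) \<noteq> {}"
    using assms(1) unfolding frac_class_def by blast
  fix p' assume p': "p' \<in> frac_class (frac_value p)"
  obtain a s where as: "p' = (a, s)" by (metis surj_pair)
  have "(\<Union>(b, t)\<in>frac_class (frac_value q). g a s b t) = X"
  proof (rule SUP_eq_const)
    show "frac_class (frac_value q) \<noteq> {}"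
      using assms(2) unfolding frac_class_def by blast
    fix q' assume q': "q' \<in> frac_class (frac_value q)"
    obtain b t where "q' = (b, t)" by (metis surj_pair)
    then show "(case q' of (b, t) \<Rightarrow> g a s b t) = X"
      using p' q' by (simp add: as frac_class_def const)
  qed
  then show "(case p' of (a, s) \<Rightarrow> \<Union>(b, t)\<in>frac_class (frac_value q). g a s b t) = X"
    by (simp add: as)
qed

text \<open>By the characterization of \<^const>\<open>frac_rel\<close>, the elements of the localization are the fibres of
  \<^const>\<open>frac_value\<close>; so it is isomorphic to the subfield of values.\<close>

lemma field_localization: "field (localization R ker)"
proof (rule field_of_subfield_image)
  let ?Q = "frac_value ` fractions"
  show "carrier (localization R ker) = frac_class ` ?Q"
  proof -
    have "frac_rel R ker `` {p} = frac_class (frac_value p)" if "p \<in> fractions" for p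
      using that by (auto simp: frac_rel_iff frac_class_def)
    then show ?thesis
      unfolding localization_def quotient_def fractions_def[symmetric] by auto
  qed
  show "inj_on frac_class ?Q"
    by (rule inj_onI) (force simp: frac_class_def)
  show "0 \<in> ?Q" using frac_value_zero by (metis image_eqI)
  show "1 \<in> ?Q" using frac_value_one by (metis image_eqI)
  show "- x \<in> ?Q" "inverse x \<in> ?Q" if x: "x \<in> ?Q" for x
  proof -
    obtain a s where as: "(a, s) \<in> fractions" "x = frac_value (a, s)"
      using x unfolding image_iff Bex_def split_paired_Ex by blast
    show "- x \<in> ?Q"
      using frac_value_uminus[OF as(1)] unfolding as(2) by (metis imageI)
    show "inverse x \<in> ?Q"
      using frac_value_inverse[OF as(1)] unfolding as(2) by (metis imageI)
  qed
  show "x + y \<in> ?Q" "x * y \<in> ?Q" if xy: "x \<in> ?Q" "y \<in> ?Q" for x y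
  proof -
    obtain a s where as: "(a, s) \<in> fractions" "x = frac_value (a, s)"
      using xy(1) unfolding image_iff Bex_def split_paired_Ex by blast
    obtain b t where bt: "(b, t) \<in> fractions" "y = frac_value (b, t)"
      using xy(2) unfolding image_iff Bex_def split_paired_Ex by blast
    note ops = frac_value_ops[OF as(1) bt(1)]
    show "x + y \<in> ?Q" "x * y \<in> ?Q"
      using imageI[OF ops(4), of frac_value] imageI[OF ops(3), of frac_value]
      by (simp_all add: as(2) bt(2) ops(1,2))
  qed
  show "\<zero>\<^bsub>localization R ker\<^esub> = frac_class 0"
    by (simp add: localization_def fraction_eq frac_value_zero)
  show "\<one>\<^bsub>localization R ker\<^esub> = frac_class 1"
    by (simp add: localization_def fraction_eq frac_value_one)
  show "frac_class x \<oplus>\<^bsub>localization R ker\<^esub> frac_class y = frac_class (x + y)"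
    "frac_class x \<otimes>\<^bsub>localization R ker\<^esub> frac_class y = frac_class (x * y)"
    if xy: "x \<in> ?Q" "y \<in> ?Q" for x y
  proof -
    obtain p q where pq: "p \<in> fractions" "q \<in> fractions" "x = frac_value p" "y = frac_value q"
      using xy by blast
    show "frac_class x \<oplus>\<^bsub>localization R ker\<^esub> frac_class y = frac_class (x + y)"
      unfolding localization_def pq(3,4) ring.simps
      using pq(1,2) by (rule UN_frac_class) (auto simp: fraction_eq frac_value_ops)
    show "frac_class x \<otimes>\<^bsub>localization R ker\<^esub> frac_class y = frac_class (x * y)"
      unfolding localization_def pq(3,4) monoid.simps
      using pq(1,2) by (rule UN_frac_class) (auto simp: fraction_eq frac_value_ops)
  qed
qed

lemma localized_prime_ker: "localized_prime R ker = {\<zero>\<^bsub>localization R ker\<^esub>}"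
proof -
  have zero: "\<zero>\<^bsub>localization R ker\<^esub> = frac_class 0"
    by (simp add: localization_def fraction_eq frac_value_zero)
  have "fraction R ker a s = frac_class 0" if "a \<in> ker" "s \<in> carrier R - ker" for a s
  proof -
    have as: "(a, s) \<in> fractions" "\<psi> a = 0" "\<psi> s \<noteq> 0"
      using that by (auto simp: fractions_def ker_def)
    then have "frac_value (a, s) = 0"
      by (simp add: frac_value_def Zero_fract_def eq_fract)
    then show ?thesis
      using fraction_eq[OF as(1)] by simp
  qed
  moreover have "\<zero> \<in> ker" "\<one> \<in> carrier R - ker"
    by (simp_all add: ker_def hom_zero hom_one)
  ultimately show ?thesis
    unfolding localized_prime_def zero by blast
qed

lemma ideal_length_localization:
  "ideal_length (localization R ker)
     (local_cohomology_0 (localization R ker) (localized_prime R ker)) = 1"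
  unfolding localized_prime_ker field.local_cohomology_0_field[OF field_localization]
  by (rule field.ideal_length_field[OF field_localization])

end

end

section \<open>Associated primes of an irredundant intersection of primes\<close>

text \<open>The kernels of the homomorphisms \<open>\<psi> i\<close> are primes that intersect in the zero ideal.  The
  element \<open>e i\<close> lies in all of them but the \<open>i\<close>-th one, which makes the intersection irredundant.\<close>

locale separated_homs_to_idom = cring R for R :: "('a, 'm) ring_scheme" (structure) +
  fixes I :: "'i set" and \<psi> :: "'i \<Rightarrow> 'a \<Rightarrow> 'k::idom" and e :: "'i \<Rightarrow> 'a"
  assumes homs: "i \<in> I \<Longrightarrow> hom_to_idom R (\<psi> i)"
    and jointly_injective: "\<lbrakk>x \<in> carrier R; \<And>i. i \<in> I \<Longrightarrow> \<psi> i x = 0\<rbrakk> \<Longrightarrow> x = \<zero>"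
    and separating: "i \<in> I \<Longrightarrow> e i \<in> carrier R" "i \<in> I \<Longrightarrow> \<psi> i (e i) \<noteq> 0"
      "\<lbrakk>i \<in> I; j \<in> I; i \<noteq> j\<rbrakk> \<Longrightarrow> \<psi> j (e i) = 0"
begin

abbreviation component :: "'i \<Rightarrow> 'a set" where
  "component i \<equiv> hom_to_idom.ker R (\<psi> i)"

lemma mem_component: "i \<in> I \<Longrightarrow> x \<in> component i \<longleftrightarrow> x \<in> carrier R \<and> \<psi> i x = 0"
  by (simp add: hom_to_idom.ker_def[OF homs])

lemma component_annihilates:
  assumes "i \<in> I" "r \<in> component i"
  shows "r \<otimes> e i = \<zero>"
proof (rule jointly_injective)
  show "r \<otimes> e i \<in> carrier R"
    using assms separating(1) by (simp add: mem_component)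
  fix j assume "j \<in> I"
  then show "\<psi> j (r \<otimes> e i) = 0"
    using assms separating by (cases "i = j") (auto simp: mem_component hom_to_idom.hom_mult[OF homs])
qed

lemma inj_on_component: "inj_on component I"
proof (rule inj_onI, rule ccontr)
  fix i j assume "i \<in> I" "j \<in> I" "component i = component j" "i \<noteq> j"
  then show False
    using mem_component[of j "e i"] mem_component[of i "e i"] separating by simp
qed

text \<open>The \<open>i\<close>-th kernel is the annihilator of \<open>e i\<close>.  Conversely, let \<open>P\<close> be the prime
  annihilator of \<open>x\<close>, and let \<open>i\<close> be such that \<open>\<psi> i x \<noteq> 0\<close>.  Then \<open>\<psi> i\<close> vanishes on \<open>P\<close>; in
  particular \<open>e i\<close> is not in \<open>P\<close>, and as \<open>e i\<close> annihilates the \<open>i\<close>-th kernel, this kernel is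
  contained in \<open>P\<close>.\<close>

lemma associated_primes_eq: "associated_primes R = component ` I"
proof (intro equalityI subsetI)
  fix P assume "P \<in> component ` I"
  then obtain i where i: "i \<in> I" "P = component i" by blast
  have "P = {r \<in> carrier R. r \<otimes> e i = \<zero>}"
  proof (intro equalityI subsetI CollectI conjI)
    fix r assume "r \<in> P"
    then show "r \<in> carrier R" "r \<otimes> e i = \<zero>"
      using i by (simp_all add: mem_component component_annihilates)
  next
    fix r assume "r \<in> {r \<in> carrier R. r \<otimes> e i = \<zero>}"
    then have "r \<in> carrier R" "\<psi> i r * \<psi> i (e i) = 0"
      using i separating(1) hom_to_idom.hom_mult[OF homs, of i r "e i"]
        hom_to_idom.hom_zero[OF homs, of i] by auto
    then show "r \<in> P"
      using i separating(2) by (simp add: mem_component)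
  qed
  moreover have "primeideal P R"
    unfolding i(2) by (rule hom_to_idom.primeideal_ker[OF homs[OF i(1)]])
  ultimately show "P \<in> associated_primes R"
    using separating(1)[OF i(1)] unfolding associated_primes_def by (intro CollectI conjI bexI[of _ "e i"])
next
  fix P assume "P \<in> associated_primes R"
  then obtain x where prime: "primeideal P R" and x: "x \<in> carrier R"
    and P: "P = {r \<in> carrier R. r \<otimes> x = \<zero>}"
    by (auto simp: associated_primes_def)
  have mem_P: "r \<in> P \<longleftrightarrow> r \<in> carrier R \<and> r \<otimes> x = \<zero>" for r
    unfolding P by blast
  have zero_P: "\<zero> \<in> P"
    using x by (simp add: mem_P)
  have "x \<noteq> \<zero>"
  proof
    assume "x = \<zero>"
    then have "carrier R = P" using mem_P r_null by blast
    then show False using primeideal.I_notcarr[OF prime] by blast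
  qed
  then obtain i where i: "i \<in> I" "\<psi> i x \<noteq> 0"
    using jointly_injective[OF x] by blast
  have vanish: "\<psi> i r = 0" if "r \<in> P" for r
  proof -
    have r: "r \<in> carrier R" "r \<otimes> x = \<zero>" using that mem_P by auto
    have "\<psi> i r * \<psi> i x = 0"
      using hom_to_idom.hom_mult[OF homs[OF i(1)] r(1) x] hom_to_idom.hom_zero[OF homs[OF i(1)]] r(2)
      by simp
    then show ?thesis using i(2) by simp
  qed
  have "P = component i"
  proof (intro equalityI subsetI)
    fix r assume "r \<in> P"
    then show "r \<in> component i"
      using vanish mem_P by (simp add: mem_component[OF i(1)])
  next
    fix r assume r: "r \<in> component i"
    have "r \<otimes> e i \<in> P"
      using component_annihilates[OF i(1) r] zero_P by simp
    moreover have "e i \<notin> P"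
      using vanish separating(2)[OF i(1)] by blast
    ultimately show "r \<in> P"
      using primeideal.I_prime[OF prime, of r "e i"] r separating(1)[OF i(1)]
      by (auto simp: mem_component[OF i(1)])
  qed
  then show "P \<in> component ` I"
    using i(1) by blast
qed

text \<open>The lengths of local cohomology all equal \<open>1\<close>, because the localizations are fields.\<close>

lemma ring_adeg_eq:
  "ring_adeg R K G d = (\<Sum>i\<in>{i \<in> I. krull_dim (R Quot component i) = enat d}.
     graded_multiplicity (R Quot component i)
       ((\<lambda>x. component i +> x) ` K) (\<lambda>t. (\<lambda>x. component i +> x) ` G t))"
proof -
  let ?I = "{i \<in> I. krull_dim (R Quot component i) = enat d}"
  have length: "ideal_length (localization R (component i))
      (local_cohomology_0 (localization R (component i)) (localized_prime R (component i))) = 1"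
    if "i \<in> I" for i
    using that by (intro hom_to_idom.ideal_length_localization[OF homs, of i "e i"])
      (simp_all add: separating component_annihilates)
  have inj: "inj_on component ?I"
    by (rule inj_on_subset[OF inj_on_component]) blast
  have primes: "{P \<in> associated_primes R. krull_dim (R Quot P) = enat d} = component ` ?I"
    unfolding associated_primes_eq by blast
  show ?thesis
    unfolding ring_adeg_def primes sum.reindex[OF inj] comp_def
    by (rule sum.cong) (simp_all add: length one_enat_def)
qed

end

section \<open>Homomorphisms of polynomial rings\<close>

lemma keys_plus_nat: "Poly_Mapping.keys (m + m') = Poly_Mapping.keys m \<union> Poly_Mapping.keys m'"
  for m m' :: "'a \<Rightarrow>\<^sub>0 nat"
  by (auto simp: in_keys_iff lookup_add)

lemma poly_mapping_sum_single:
  "(\<Sum>m\<in>Poly_Mapping.keys f. Poly_Mapping.single m (Poly_Mapping.lookup f m)) = f"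
  for f :: "'a \<Rightarrow>\<^sub>0 'b::comm_monoid_add"
  by (rule poly_mapping_eqI)
    (auto simp: lookup_sum lookup_single when_def sum.delta in_keys_iff)

lemma poly_mapping_additive_induct [case_names single plus]:
  fixes f :: "'a \<Rightarrow>\<^sub>0 'b::comm_monoid_add"
  assumes single: "\<And>m c. Q (Poly_Mapping.single m c)"
    and plus: "\<And>f g. Q f \<Longrightarrow> Q g \<Longrightarrow> Q (f + g)"
  shows "Q f"
proof -
  have "Q (\<Sum>m\<in>A. Poly_Mapping.single m (Poly_Mapping.lookup f m))" if "finite A" for A
    using that
  proof (induction A)
    case empty
    show ?case using single[of undefined 0] by simp
  qed (simp add: single plus)
  from this[OF finite_keys, of f] show ?thesis
    by (simp add: poly_mapping_sum_single)
qed

text \<open>An additive map between monoid algebras is determined by its values on monomials.\<close>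

lemma multiplicative_if_on_singles:
  fixes T :: "('a::comm_monoid_add \<Rightarrow>\<^sub>0 'k::comm_ring_1) \<Rightarrow> ('b::comm_monoid_add \<Rightarrow>\<^sub>0 'k)"
  assumes add: "\<And>f g. T (f + g) = T f + T g"
    and single: "\<And>m m' c c'. T (Poly_Mapping.single (m + m') (c * c')) =
      T (Poly_Mapping.single m c) * T (Poly_Mapping.single m' c')"
  shows "T (f * g) = T f * T g"
proof (induction f rule: poly_mapping_additive_induct)
  case (single m c)
  show ?case
    by (induction g rule: poly_mapping_additive_induct)
      (simp_all add: mult_single assms distrib_left)
qed (simp add: add distrib_right)

definition keep_vars :: "'v set \<Rightarrow> (('v \<Rightarrow>\<^sub>0 nat) \<Rightarrow>\<^sub>0 'k::comm_ring_1) \<Rightarrow> ('v \<Rightarrow>\<^sub>0 nat) \<Rightarrow>\<^sub>0 'k" where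
  "keep_vars V f =
     Poly_Mapping.Abs_poly_mapping (\<lambda>m. Poly_Mapping.lookup f m when Poly_Mapping.keys m \<subseteq> V)"

lemma lookup_keep_vars:
  "Poly_Mapping.lookup (keep_vars V f) m = (Poly_Mapping.lookup f m when Poly_Mapping.keys m \<subseteq> V)"
proof -
  have "{m. (Poly_Mapping.lookup f m when Poly_Mapping.keys m \<subseteq> V) \<noteq> 0} \<subseteq> Poly_Mapping.keys f"
    by (auto simp: in_keys_iff)
  then show ?thesis
    unfolding keep_vars_def by (subst lookup_Abs_poly_mapping) (auto intro: finite_subset)
qed

lemma keep_vars_add: "keep_vars V (f + g) = keep_vars V f + keep_vars V g"
  by (rule poly_mapping_eqI) (simp add: lookup_keep_vars lookup_add when_add_distrib)

lemma keep_vars_single: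
  "keep_vars V (Poly_Mapping.single m c) =
    (if Poly_Mapping.keys m \<subseteq> V then Poly_Mapping.single m c else 0)"
  by (rule poly_mapping_eqI) (auto simp: lookup_keep_vars lookup_single when_def)

lemma keep_vars_mult: "keep_vars V (f * g) = keep_vars V f * keep_vars V g"
  by (rule multiplicative_if_on_singles)
    (simp_all add: keep_vars_add keep_vars_single keys_plus_nat mult_single)

text \<open>\<^const>\<open>Poly_Mapping.map_key\<close> precomposes with its first argument.  Hence the outer use
  precomposes the coefficient function with \<open>m \<mapsto> m \<circ> \<sigma>\<close>, which for bijective \<open>\<sigma>\<close> amounts to
  the substitution of the variable \<open>x\<^bsub>\<sigma> j\<^esub>\<close> for \<open>x\<^sub>j\<close>.\<close>

definition relabel :: "('v \<Rightarrow> 'w) \<Rightarrow> (('v \<Rightarrow>\<^sub>0 nat) \<Rightarrow>\<^sub>0 'k::comm_ring_1) \<Rightarrow> ('w \<Rightarrow>\<^sub>0 nat) \<Rightarrow>\<^sub>0 'k" where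
  "relabel \<sigma> = Poly_Mapping.map_key (Poly_Mapping.map_key \<sigma>)"

context
  fixes \<sigma> :: "'v \<Rightarrow> 'w"
  assumes \<sigma>: "bij \<sigma>"
begin

lemma inj_relabelling: "inj \<sigma>" "inj (inv_into UNIV \<sigma>)"
  using \<sigma> bij_imp_bij_inv[OF \<sigma>] by (auto simp: bij_def)

lemma map_key_inverses:
  "Poly_Mapping.map_key \<sigma> (Poly_Mapping.map_key (inv_into UNIV \<sigma>) (m :: 'v \<Rightarrow>\<^sub>0 nat)) = m"
  "Poly_Mapping.map_key (inv_into UNIV \<sigma>) (Poly_Mapping.map_key \<sigma> (m' :: 'w \<Rightarrow>\<^sub>0 nat)) = m'"
  using \<sigma> by (simp_all add: map_key_compose inj_relabelling bij_is_inj bij_is_surj surj_iff[THEN iffD1]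
      inv_o_cancel map_key_id[unfolded id_def[symmetric]])

lemma inj_map_key: "inj (Poly_Mapping.map_key \<sigma> :: ('w \<Rightarrow>\<^sub>0 nat) \<Rightarrow> _)"
  by (metis injI map_key_inverses(2))

lemma lookup_relabel:
  "Poly_Mapping.lookup (relabel \<sigma> f) m = Poly_Mapping.lookup f (Poly_Mapping.map_key \<sigma> m)"
  by (simp add: relabel_def map_key.rep_eq[OF inj_map_key])

lemma relabel_add: "relabel \<sigma> (f + g) = relabel \<sigma> f + relabel \<sigma> g"
  by (simp add: relabel_def map_key_plus[OF inj_map_key])

lemma relabel_single:
  "relabel \<sigma> (Poly_Mapping.single m c) = Poly_Mapping.single (Poly_Mapping.map_key (inv_into UNIV \<sigma>) m) c"
  using map_key_single[OF inj_map_key, of "Poly_Mapping.map_key (inv_into UNIV \<sigma>) m" c]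
  by (simp add: relabel_def map_key_inverses)

lemma relabel_mult: "relabel \<sigma> (f * g) = relabel \<sigma> f * relabel \<sigma> g"
  by (rule multiplicative_if_on_singles)
    (simp_all add: relabel_add relabel_single map_key_plus inj_relabelling mult_single)

end

lemma sum_lookup_map_key:
  assumes "bij \<sigma>"
  shows "(\<Sum>j\<in>Poly_Mapping.keys (Poly_Mapping.map_key \<sigma> m). Poly_Mapping.lookup (Poly_Mapping.map_key \<sigma> m) j) =
    (\<Sum>j\<in>Poly_Mapping.keys m. Poly_Mapping.lookup m j)"
proof -
  have "inj \<sigma>" "surj \<sigma>" using assms by (simp_all add: bij_def)
  then have "bij_betw \<sigma> (Poly_Mapping.keys (Poly_Mapping.map_key \<sigma> m)) (Poly_Mapping.keys m)"
    by (auto simp: bij_betw_def keys_map_key intro: inj_on_subset)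
  from sum.reindex_bij_betw[OF this, of "Poly_Mapping.lookup m"] show ?thesis
    by (simp add: map_key.rep_eq \<open>inj \<sigma>\<close>)
qed

text \<open>The substitution of \<open>x\<^bsub>\<sigma> j\<^esub>\<close> for \<open>x\<^sub>j\<close> if \<open>\<sigma> j\<close> is in \<open>{1..k}\<close>, and of \<open>0\<close> otherwise.\<close>

definition face_hom ::
    "(nat \<Rightarrow> nat) \<Rightarrow> nat \<Rightarrow> ((nat \<Rightarrow>\<^sub>0 nat) \<Rightarrow>\<^sub>0 'k::field) \<Rightarrow> (nat \<Rightarrow>\<^sub>0 nat) \<Rightarrow>\<^sub>0 'k" where
  "face_hom \<sigma> k f = keep_vars {1..k} (relabel \<sigma> f)"

context
  fixes \<sigma> :: "nat \<Rightarrow> nat" and k :: nat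
  assumes \<sigma>: "bij \<sigma>"
begin

lemma face_hom_add: "face_hom \<sigma> k (f + g) = face_hom \<sigma> k f + face_hom \<sigma> k g"
  by (simp add: face_hom_def keep_vars_add relabel_add[OF \<sigma>])

lemma face_hom_mult: "face_hom \<sigma> k (f * g) = face_hom \<sigma> k f * face_hom \<sigma> k g"
  by (simp add: face_hom_def keep_vars_mult relabel_mult[OF \<sigma>])

lemma face_hom_constant: "face_hom \<sigma> k (Poly_Mapping.single 0 c) = Poly_Mapping.single 0 c"
  by (simp add: face_hom_def keep_vars_single relabel_single[OF \<sigma>] map_key_zero[OF inj_relabelling(2)[OF \<sigma>]])

lemma face_hom_one: "face_hom \<sigma> k 1 = 1"
  using face_hom_constant[of 1] by simp

lemma lookup_face_hom:
  "Poly_Mapping.lookup (face_hom \<sigma> k f) m =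
    (Poly_Mapping.lookup f (Poly_Mapping.map_key \<sigma> m) when Poly_Mapping.keys m \<subseteq> {1..k})"
  by (simp add: face_hom_def lookup_keep_vars lookup_relabel[OF \<sigma>])

lemma face_hom_closed: "face_hom \<sigma> k f \<in> carrier (poly_ring k)"
  by (auto simp: poly_ring_def in_keys_iff lookup_face_hom)

lemma face_hom_eq_0_iff:
  "face_hom \<sigma> k f = 0 \<longleftrightarrow> (\<forall>m\<in>Poly_Mapping.keys f. \<not> Poly_Mapping.keys m \<subseteq> \<sigma> -` {1..k})"
proof -
  have keys: "Poly_Mapping.keys (Poly_Mapping.map_key \<sigma> m) \<subseteq> \<sigma> -` {1..k} \<longleftrightarrow>
      Poly_Mapping.keys m \<subseteq> {1..k}" for m :: "nat \<Rightarrow>\<^sub>0 nat"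
  proof -
    have "surj \<sigma>" using \<sigma> by (rule bij_is_surj)
    then show ?thesis
      unfolding keys_map_key[OF inj_relabelling(1)[OF \<sigma>]] by (metis surj_image_vimage_eq vimage_mono image_mono)
  qed
  have "face_hom \<sigma> k f = 0 \<longleftrightarrow>
      (\<forall>m. Poly_Mapping.keys m \<subseteq> {1..k} \<longrightarrow> Poly_Mapping.map_key \<sigma> m \<notin> Poly_Mapping.keys f)"
    by (auto simp: poly_mapping_eq_iff fun_eq_iff lookup_face_hom in_keys_iff when_def)
  also have "\<dots> \<longleftrightarrow> (\<forall>m\<in>Poly_Mapping.keys f. \<not> Poly_Mapping.keys m \<subseteq> \<sigma> -` {1..k})"
    using keys map_key_inverses(1)[OF \<sigma>] by metis
  finally show ?thesis .
qed

lemma face_hom_homogeneous: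
  assumes "f \<in> homogeneous_polys n t"
  shows "face_hom \<sigma> k f \<in> homogeneous_polys k t"
proof -
  have "(\<Sum>j\<in>Poly_Mapping.keys m. Poly_Mapping.lookup m j) = t"
    if "m \<in> Poly_Mapping.keys (face_hom \<sigma> k f)" for m
  proof -
    have "Poly_Mapping.map_key \<sigma> m \<in> Poly_Mapping.keys f"
      using that by (auto simp: in_keys_iff lookup_face_hom)
    then show ?thesis
      using assms sum_lookup_map_key[OF \<sigma>, of m] by (simp add: homogeneous_polys_def)
  qed
  then show ?thesis
    using face_hom_closed by (simp add: homogeneous_polys_def)
qed

text \<open>Renaming the variables back gives a homogeneous preimage of the same degree.\<close>

lemma face_hom_section:
  assumes n: "\<sigma> -` {1..k} \<subseteq> {1..n}" and g: "g \<in> carrier (poly_ring k)"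
  shows "\<exists>f\<in>carrier (poly_ring n). face_hom \<sigma> k f = g \<and>
    (\<forall>t. g \<in> homogeneous_polys k t \<longrightarrow> f \<in> homogeneous_polys n t)"
proof -
  have inv: "bij (inv_into UNIV \<sigma>)" using \<sigma> by (rule bij_imp_bij_inv)
  let ?f = "relabel (inv_into UNIV \<sigma>) g"
  have key: "Poly_Mapping.map_key (inv_into UNIV \<sigma>) m \<in> Poly_Mapping.keys g"
    if "m \<in> Poly_Mapping.keys ?f" for m
    using that by (simp add: in_keys_iff lookup_relabel[OF inv])
  have "Poly_Mapping.keys m \<subseteq> {1..n}" if "m \<in> Poly_Mapping.keys ?f" for m
  proof -
    have "inv_into UNIV \<sigma> -` Poly_Mapping.keys m \<subseteq> {1..k}"
      using key[OF that] g unfolding poly_ring_def keys_map_key[OF inj_relabelling(2)[OF \<sigma>], symmetric]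
      by simp
    then have "Poly_Mapping.keys m \<subseteq> \<sigma> -` {1..k}"
      using inv_f_f[OF inj_relabelling(1)[OF \<sigma>]] by auto
    then show ?thesis using n by blast
  qed
  then have f: "?f \<in> carrier (poly_ring n)"
    by (simp add: poly_ring_def)
  have "face_hom \<sigma> k ?f = g"
  proof (rule poly_mapping_eqI)
    fix m
    show "Poly_Mapping.lookup (face_hom \<sigma> k ?f) m = Poly_Mapping.lookup g m"
      using g by (auto simp: lookup_face_hom lookup_relabel[OF inv] map_key_inverses(2)[OF \<sigma>]
          poly_ring_def when_def in_keys_iff)
  qed
  moreover have "?f \<in> homogeneous_polys n t" if "g \<in> homogeneous_polys k t" for t
    using that f key sum_lookup_map_key[OF inv] unfolding homogeneous_polys_def mem_Collect_eq by metis
  ultimately show ?thesis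
    using f by blast
qed

end

text \<open>The labelling of \<open>F\<close> by \<open>{1..k}\<close> is extended to a bijection of all natural numbers by matching
  the infinite complements of these sets, in order to make the renaming of variables invertible.\<close>

lemma exists_bij_onto_initial_segment:
  assumes "finite F" "card F = k"
  shows "\<exists>\<sigma> :: nat \<Rightarrow> nat. bij \<sigma> \<and> \<sigma> -` {1..k} = F"
proof -
  obtain a where a: "bij_betw a F {1..k}"
    using assms finite_same_card_bij[of F "{1..k}"] by auto
  have "infinite (- F)" "infinite (- {1..k})"
    using assms(1) by (auto simp: finite_compl)
  then have "bij_betw (enumerate (- {1..k}) \<circ> inv_into UNIV (enumerate (- F))) (- F) (- {1..k})"
    by (intro bij_betw_trans[OF bij_betw_inv_into] bij_enumerate)
  then obtain b where b: "bij_betw b (- F) (- {1..k})" by blast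
  let ?\<sigma> = "\<lambda>x. if x \<in> F then a x else b x"
  have "bij_betw ?\<sigma> (F \<union> - F) ({1..k} \<union> - {1..k})"
    by (rule bij_betw_disjoint_Un[OF a b]) auto
  then have "bij ?\<sigma>" by simp
  moreover have "?\<sigma> -` {1..k} = F"
    using bij_betw_apply[OF a] bij_betw_apply[OF b] by (auto split: if_splits)
  ultimately show ?thesis by blast
qed

subsection \<open>Polynomial rings as records\<close>

lemma poly_ring_simps [simp]:
  "x \<otimes>\<^bsub>poly_ring n\<^esub> y = x * y" "x \<oplus>\<^bsub>poly_ring n\<^esub> y = x + y"
  "\<one>\<^bsub>poly_ring n\<^esub> = 1" "\<zero>\<^bsub>poly_ring n\<^esub> = 0"
  by (simp_all add: poly_ring_def)

lemma mem_poly_ring: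
  "f \<in> carrier (poly_ring n) \<longleftrightarrow> (\<forall>m\<in>Poly_Mapping.keys f. Poly_Mapping.keys m \<subseteq> {1..n})"
  by (simp add: poly_ring_def)

lemma poly_ring_closed:
  assumes "f \<in> carrier (poly_ring n)" "g \<in> carrier (poly_ring n)"
  shows "f + g \<in> carrier (poly_ring n)" "f * g \<in> carrier (poly_ring n)"
proof -
  show "f + g \<in> carrier (poly_ring n)"
    using assms keys_add[of f g] unfolding mem_poly_ring by blast
  show "f * g \<in> carrier (poly_ring n)"
    using assms keys_mult[of f g] unfolding mem_poly_ring by (fastforce simp: keys_plus_nat)
qed

lemma uminus_in_poly_ring:
  "f \<in> carrier (poly_ring n) \<Longrightarrow> - f \<in> carrier (poly_ring n)"
  by (simp add: mem_poly_ring in_keys_iff)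

lemma zero_one_in_poly_ring: "0 \<in> carrier (poly_ring n)" "1 \<in> carrier (poly_ring n)"
  by (simp_all add: mem_poly_ring)

lemma constant_in_poly_ring: "Poly_Mapping.single 0 c \<in> carrier (poly_ring n)"
  by (simp add: mem_poly_ring)

lemma cring_poly_ring: "cring (poly_ring n)"
proof (rule cringI)
  show "abelian_group (poly_ring n)"
  proof (rule abelian_groupI)
    fix f assume "f \<in> carrier (poly_ring n)"
    then show "\<exists>g\<in>carrier (poly_ring n). g \<oplus>\<^bsub>poly_ring n\<^esub> f = \<zero>\<^bsub>poly_ring n\<^esub>"
      by (intro bexI[of _ "- f"]) (simp_all add: uminus_in_poly_ring)
  qed (simp_all add: poly_ring_closed(1) add.assoc add.commute zero_one_in_poly_ring)
  show "comm_monoid (poly_ring n)"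
    by (rule comm_monoidI)
      (simp_all add: poly_ring_closed(2) mult.assoc mult.commute zero_one_in_poly_ring)
qed (simp add: distrib_right)

lemma uminus_poly_ring:
  fixes f :: "(nat \<Rightarrow>\<^sub>0 nat) \<Rightarrow>\<^sub>0 'k::field"
  assumes "f \<in> carrier (poly_ring n)"
  shows "\<ominus>\<^bsub>poly_ring n\<^esub> f = - f"
proof -
  interpret cring "poly_ring n :: ((nat \<Rightarrow>\<^sub>0 nat) \<Rightarrow>\<^sub>0 'k) ring" by (rule cring_poly_ring)
  show ?thesis
    by (rule minus_equality) (simp_all add: assms uminus_in_poly_ring)
qed

lemma subfield_poly_constants: "subfield (poly_constants :: ((nat \<Rightarrow>\<^sub>0 nat) \<Rightarrow>\<^sub>0 'k::field) set) (poly_ring n)"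
proof -
  let ?K = "poly_constants :: ((nat \<Rightarrow>\<^sub>0 nat) \<Rightarrow>\<^sub>0 'k) set"
  interpret cring "poly_ring n :: ((nat \<Rightarrow>\<^sub>0 nat) \<Rightarrow>\<^sub>0 'k) ring" by (rule cring_poly_ring)
  have sub: "subring ?K (poly_ring n)"
  proof (rule subringI)
    show "?K \<subseteq> carrier (poly_ring n)" by (auto simp: poly_constants_def constant_in_poly_ring)
    show "\<one>\<^bsub>poly_ring n\<^esub> \<in> ?K" by (metis poly_constants_def poly_ring_simps(3) rangeI single_one)
    fix f g assume "f \<in> ?K" "g \<in> ?K"
    then show "\<ominus>\<^bsub>poly_ring n\<^esub> f \<in> ?K" "f \<otimes>\<^bsub>poly_ring n\<^esub> g \<in> ?K" "f \<oplus>\<^bsub>poly_ring n\<^esub> g \<in> ?K"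
      by (auto simp: poly_constants_def uminus_poly_ring constant_in_poly_ring mult_single
          simp flip: single_uminus single_add)
  qed
  have "k \<in> Units (poly_ring n \<lparr>carrier := ?K\<rparr>)" if k: "k \<in> ?K" "k \<noteq> 0" for k
  proof -
    obtain c where c: "k = Poly_Mapping.single 0 c"
      using k(1) by (auto simp: poly_constants_def)
    moreover have "c \<noteq> 0"
      using k(2) c by auto
    ultimately show ?thesis
      using k unfolding Units_def poly_constants_def
      by (auto simp: mult_single intro!: exI[of _ "inverse c"])
  qed
  moreover have "0 \<notin> Units (poly_ring n \<lparr>carrier := ?K\<rparr>)"
    by (simp add: Units_def)
  ultimately show ?thesis
    by (intro subfieldI subcringI'[OF sub]) (auto simp: Units_def)
qed

section \<open>Quotients and induced homomorphisms\<close>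

text \<open>By the isomorphism theorem the residue ring modulo the kernel inherits the invariants of the
  target, including those defined by coefficients and grading.\<close>

lemma
  assumes hom: "ring_hom_ring R S h" and R: "cring R" and S: "cring S"
    and surj: "h ` carrier R = carrier S"
  shows krull_dim_quotient_kernel: "krull_dim (R Quot a_kernel R S h) = krull_dim S"
    and graded_multiplicity_quotient_kernel:
      "\<lbrakk>K \<subseteq> carrier R; \<And>t. G t \<subseteq> carrier R; subfield (h ` K) S;
        \<And>t. \<exists>n. ring.dimension S n (h ` K) (h ` G t)\<rbrakk> \<Longrightarrow>
       graded_multiplicity (R Quot a_kernel R S h)
         ((\<lambda>x. a_kernel R S h +>\<^bsub>R\<^esub> x) ` K) (\<lambda>t. (\<lambda>x. a_kernel R S h +>\<^bsub>R\<^esub> x) ` G t) =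
       graded_multiplicity S (h ` K) (\<lambda>t. h ` G t)"
proof -
  interpret ring_hom_ring R S h by (rule hom)
  let ?N = "a_kernel R S h"
  interpret N: ideal ?N R by (rule kernel_is_ideal)
  let ?Q = "R Quot ?N"
  let ?\<theta> = "\<lambda>X. the_elem (h ` X)"
  have Q: "cring ?Q"
    by (rule N.quotient_is_cring[OF R])
  have iso: "?\<theta> \<in> ring_iso ?Q S"
    by (rule FactRing_iso_set[OF surj])
  define g where "g = inv_into (carrier ?Q) ?\<theta>"
  have g: "g \<in> ring_iso S ?Q"
    unfolding g_def by (rule ring_iso_set_sym[OF cring.axioms(1)[OF Q] iso])
  show dim: "krull_dim ?Q = krull_dim S"
    by (rule krull_dim_ring_iso[OF S Q g])
  have coset: "?N +>\<^bsub>R\<^esub> x \<in> carrier ?Q" if "x \<in> carrier R" for x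
    using that unfolding FactRing_def A_RCOSETS_def' by auto
  have g_image: "g (h x) = ?N +>\<^bsub>R\<^esub> x" if "x \<in> carrier R" for x
  proof -
    have "inj_on ?\<theta> (carrier ?Q)"
      using iso by (simp add: ring_iso_def bij_betw_def)
    from inv_into_f_f[OF this coset[OF that]] show ?thesis
      by (simp add: g_def the_elem_simp[OF that])
  qed
  show "graded_multiplicity ?Q ((\<lambda>x. ?N +>\<^bsub>R\<^esub> x) ` K) (\<lambda>t. (\<lambda>x. ?N +>\<^bsub>R\<^esub> x) ` G t) =
      graded_multiplicity S (h ` K) (\<lambda>t. h ` G t)"
    if K: "K \<subseteq> carrier R" "subfield (h ` K) S" and G: "\<And>t. G t \<subseteq> carrier R"
      "\<And>t. \<exists>n. ring.dimension S n (h ` K) (h ` G t)"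
  proof -
    have "\<one>\<^bsub>?Q\<^esub> \<noteq> \<zero>\<^bsub>?Q\<^esub>"
    proof
      assume "\<one>\<^bsub>?Q\<^esub> = \<zero>\<^bsub>?Q\<^esub>"
      then have "?N +>\<^bsub>R\<^esub> \<one>\<^bsub>R\<^esub> = ?N"
        by (simp add: FactRing_def)
      then have "\<one>\<^bsub>R\<^esub> \<in> ?N"
        using N.a_rcos_self[OF R.one_closed] by simp
      then have "h \<one>\<^bsub>R\<^esub> = \<zero>\<^bsub>S\<^esub>"
        unfolding a_kernel_def' by blast
      then show False
        using subfieldE(6)[OF K(2)] hom_one by metis
    qed
    then have "graded_multiplicity ?Q (g ` h ` K) (\<lambda>t. g ` h ` G t) =
        graded_multiplicity S (h ` K) (\<lambda>t. h ` G t)"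
    proof (rule graded_multiplicity_ring_iso[OF S Q g K(2)])
      show "h ` G t \<subseteq> carrier S" for t
      using G(1)[of t] by auto
    qed (rule G(2))
    moreover have "g ` h ` A = (\<lambda>x. ?N +>\<^bsub>R\<^esub> x) ` A" if "A \<subseteq> carrier R" for A
      unfolding image_image using that by (intro image_cong refl g_image) blast
    ultimately show ?thesis
      by (simp only: G(1) K(1))
  qed
qed

lemma the_elem_image_coset:
  assumes "hom_to_idom R h" "ideal I R" and h: "\<And>x. x \<in> I \<Longrightarrow> h x = 0" and x: "x \<in> carrier R"
  shows "the_elem (h ` (I +>\<^bsub>R\<^esub> x)) = h x"
proof -
  interpret hom_to_idom R h by fact
  interpret ideal I R by fact
  have "h ` (I +>\<^bsub>R\<^esub> x) \<subseteq> {h x}"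
    using x h by (auto simp: a_r_coset_def' hom_add a_Hcarr)
  moreover have "I +>\<^bsub>R\<^esub> x \<noteq> {}"
    using a_rcos_self[OF x] by blast
  ultimately have "h ` (I +>\<^bsub>R\<^esub> x) = {h x}"
    by (metis image_is_empty subset_singletonD)
  then show ?thesis by simp
qed

lemma hom_to_idom_quotient:
  fixes R (structure)
  assumes hom: "hom_to_idom R h" and I: "ideal I R" and h: "\<And>x. x \<in> I \<Longrightarrow> h x = 0"
  shows "hom_to_idom (R Quot I) (\<lambda>X. the_elem (h ` X))"
proof -
  interpret hom_to_idom R h by (rule hom)
  interpret ideal I R by (rule I)
  note coset = the_elem_image_coset[OF hom I h]
  have rep: "\<exists>x\<in>carrier R. X = I +> x" if "X \<in> carrier (R Quot I)" for X
    using that unfolding FactRing_def A_RCOSETS_def' by auto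
  show ?thesis
  proof (intro hom_to_idom.intro hom_to_idom_axioms.intro)
    show "cring (R Quot I)" by (rule quotient_is_cring[OF is_cring])
    fix X Y assume "X \<in> carrier (R Quot I)" "Y \<in> carrier (R Quot I)"
    then obtain x y where xy: "x \<in> carrier R" "X = I +> x" "y \<in> carrier R" "Y = I +> y"
      using rep by metis
    have "X \<oplus>\<^bsub>R Quot I\<^esub> Y = I +> (x \<oplus> y)" "X \<otimes>\<^bsub>R Quot I\<^esub> Y = I +> (x \<otimes> y)"
      using xy by (simp_all add: FactRing_def a_rcos_sum rcoset_mult_add)
    then show "the_elem (h ` (X \<oplus>\<^bsub>R Quot I\<^esub> Y)) = the_elem (h ` X) + the_elem (h ` Y)"
      "the_elem (h ` (X \<otimes>\<^bsub>R Quot I\<^esub> Y)) = the_elem (h ` X) * the_elem (h ` Y)"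
      using xy by (simp_all add: coset hom_add hom_mult)
  next
    show "the_elem (h ` \<one>\<^bsub>R Quot I\<^esub>) = 1"
      by (simp add: FactRing_def coset hom_one)
  qed
qed

lemma hom_to_idom_face_hom:
  assumes "bij \<sigma>"
  shows "hom_to_idom (poly_ring n) (face_hom \<sigma> k)"
  by (intro hom_to_idom.intro hom_to_idom_axioms.intro cring_poly_ring)
    (simp_all add: face_hom_add face_hom_mult face_hom_one assms)

section \<open>The Stanley--Reisner ideal\<close>

lemma prod_poly_var:
  "finite F \<Longrightarrow> (\<Prod>j\<in>F. poly_var j) = Poly_Mapping.single (\<Sum>j\<in>F. Poly_Mapping.single j 1) 1"
  by (induction F rule: finite_induct) (simp_all add: poly_var_def mult_single)

lemma keys_sum_single:
  "finite F \<Longrightarrow> Poly_Mapping.keys (\<Sum>j\<in>F. Poly_Mapping.single j (1::nat)) = F"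
  by (induction F rule: finite_induct) (simp_all add: keys_plus_nat)

lemma monomial_dvd_by_support:
  fixes m :: "nat \<Rightarrow>\<^sub>0 nat"
  shows "\<exists>m'. m = m' + (\<Sum>j\<in>Poly_Mapping.keys m. Poly_Mapping.single j 1)"
proof
  let ?s = "\<Sum>j\<in>Poly_Mapping.keys m. Poly_Mapping.single j (1::nat)"
  have "Poly_Mapping.lookup ?s j \<le> Poly_Mapping.lookup m j" for j
    by (auto simp: lookup_sum lookup_single when_def in_keys_iff sum.delta)
  then show "m = (m - ?s) + ?s"
    by (intro poly_mapping_eqI) (simp add: lookup_add lookup_minus)
qed

text \<open>The polynomials all of whose monomials are supported on non-faces form an ideal, because
  multiplication can only enlarge supports and non-faces are closed under taking supersets.  A
  monomial of this kind is a multiple of the generator given by its support.\<close>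

lemma sr_ideal_eq:
  assumes \<Gamma>: "\<Gamma> \<in> simplicial_complexes n"
  shows "(sr_ideal n \<Gamma> :: ((nat \<Rightarrow>\<^sub>0 nat) \<Rightarrow>\<^sub>0 'k::field) set) =
    {f \<in> carrier (poly_ring n). \<forall>m\<in>Poly_Mapping.keys f. Poly_Mapping.keys m \<notin> \<Gamma>}" (is "_ = ?J")
    and ideal_sr_ideal: "ideal (sr_ideal n \<Gamma> :: ((nat \<Rightarrow>\<^sub>0 nat) \<Rightarrow>\<^sub>0 'k::field) set) (poly_ring n)"
proof -
  interpret cring "poly_ring n :: ((nat \<Rightarrow>\<^sub>0 nat) \<Rightarrow>\<^sub>0 'k) ring" by (rule cring_poly_ring)
  let ?gens = "{\<Prod>j\<in>F. poly_var j | F. F \<subseteq> {1..n} \<and> F \<notin> \<Gamma>} :: ((nat \<Rightarrow>\<^sub>0 nat) \<Rightarrow>\<^sub>0 'k) set"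
  have fin: "finite F" if "F \<subseteq> {1..n}" for F :: "nat set"
    using that finite_subset by blast
  have gens: "?gens \<subseteq> carrier (poly_ring n)"
    by (auto simp: prod_poly_var fin mem_poly_ring keys_sum_single simp del: One_nat_def)
  show ideal: "ideal (sr_ideal n \<Gamma> :: ((nat \<Rightarrow>\<^sub>0 nat) \<Rightarrow>\<^sub>0 'k) set) (poly_ring n)"
    unfolding sr_ideal_def by (rule genideal_ideal[OF gens])
  have "ideal ?J (poly_ring n)"
  proof (rule idealI)
    show "subgroup ?J (add_monoid (poly_ring n))"
    proof (rule subgroup.intro)
      show "f \<otimes>\<^bsub>add_monoid (poly_ring n)\<^esub> g \<in> ?J" if "f \<in> ?J" "g \<in> ?J" for f g
        using that poly_ring_closed(1)[of f n g] keys_add[of f g] by auto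
      show "inv\<^bsub>add_monoid (poly_ring n)\<^esub> f \<in> ?J" if "f \<in> ?J" for f
        using that unfolding a_inv_def[symmetric]
        by (simp add: uminus_poly_ring uminus_in_poly_ring in_keys_iff)
    qed (auto simp: zero_one_in_poly_ring)
    have mult: "f * g \<in> ?J" if f: "f \<in> ?J" and g: "g \<in> carrier (poly_ring n)" for f g
    proof -
      have "Poly_Mapping.keys m \<notin> \<Gamma>" if m: "m \<in> Poly_Mapping.keys (f * g)" for m
      proof -
        obtain a b where "a \<in> Poly_Mapping.keys f" "m = a + b"
          using m keys_mult[of f g] by blast
        then show ?thesis
          using f face_subset[OF \<Gamma>, of "Poly_Mapping.keys m" "Poly_Mapping.keys a"]
          by (auto simp: keys_plus_nat)
      qed
      then show ?thesis
        using f g poly_ring_closed(2) by blast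
    qed
    show "g \<otimes>\<^bsub>poly_ring n\<^esub> f \<in> ?J" "f \<otimes>\<^bsub>poly_ring n\<^esub> g \<in> ?J"
      if "f \<in> ?J" "g \<in> carrier (poly_ring n)" for f g
      using mult[OF that] by (simp_all add: mult.commute)
  qed (rule ring_axioms)
  moreover have "?gens \<subseteq> ?J"
    using gens by (auto simp: prod_poly_var fin keys_sum_single simp del: One_nat_def)
  ultimately have "sr_ideal n \<Gamma> \<subseteq> ?J"
    unfolding sr_ideal_def by (rule genideal_minimal)
  moreover have "?J \<subseteq> sr_ideal n \<Gamma>"
  proof
    interpret ideal "sr_ideal n \<Gamma> :: ((nat \<Rightarrow>\<^sub>0 nat) \<Rightarrow>\<^sub>0 'k) set" "poly_ring n" by (rule ideal)
    fix f assume f: "f \<in> ?J"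
    have monomial: "Poly_Mapping.single m c \<in> sr_ideal n \<Gamma>"
      if m: "m \<in> Poly_Mapping.keys f" for m and c :: 'k
    proof -
      let ?F = "Poly_Mapping.keys m"
      have F: "?F \<subseteq> {1..n}" "?F \<notin> \<Gamma>"
        using f m by (auto simp: poly_ring_def)
      obtain m' where m': "m = m' + (\<Sum>j\<in>?F. Poly_Mapping.single j 1)"
        using monomial_dvd_by_support by blast
      then have "Poly_Mapping.keys m' \<subseteq> {1..n}"
        using F(1) keys_plus_nat[of m'] by (metis Un_subset_iff)
      then have "Poly_Mapping.single m' c \<in> carrier (poly_ring n)"
        by (simp add: mem_poly_ring)
      moreover have "(\<Prod>j\<in>?F. poly_var j :: (nat \<Rightarrow>\<^sub>0 nat) \<Rightarrow>\<^sub>0 'k) \<in> sr_ideal n \<Gamma>"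
      proof -
        have "(\<Prod>j\<in>?F. poly_var j) \<in> ?gens" using F by (intro CollectI exI[of _ ?F]) simp
        then show ?thesis
          unfolding sr_ideal_def by (rule subsetD[OF genideal_self[OF gens]])
      qed
      ultimately have "Poly_Mapping.single m' c * (\<Prod>j\<in>?F. poly_var j) \<in> sr_ideal n \<Gamma>"
        using I_l_closed by simp
      then show ?thesis
        using m' by (simp add: prod_poly_var mult_single)
    qed
    have "(\<Sum>m\<in>A. Poly_Mapping.single m (Poly_Mapping.lookup f m)) \<in> sr_ideal n \<Gamma>"
      if "A \<subseteq> Poly_Mapping.keys f" for A
      using finite_subset[OF that finite_keys] that
    proof (induction A rule: finite_induct)
      case empty
      show ?case using zero_closed by simp
    next
      case (insert m A)
      then show ?case
        using a_closed[OF monomial, of m] by simp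
    qed
    from this[of "Poly_Mapping.keys f"] show "f \<in> sr_ideal n \<Gamma>"
      by (simp add: poly_mapping_sum_single)
  qed
  ultimately show "sr_ideal n \<Gamma> = ?J" by blast
qed

section \<open>The Stanley--Reisner ring as a subring of polynomial rings on the facets\<close>

definition face_labelling :: "nat set \<Rightarrow> nat \<Rightarrow> nat" where
  "face_labelling F = (SOME \<sigma>. bij \<sigma> \<and> \<sigma> -` {1..card F} = F)"

lemma face_labelling:
  assumes "finite F"
  shows "bij (face_labelling F)" "face_labelling F -` {1..card F} = F"
  using someI_ex[OF exists_bij_onto_initial_segment[OF assms refl]]
  by (simp_all add: face_labelling_def)

definition facet_hom ::
    "nat set \<Rightarrow> ((nat \<Rightarrow>\<^sub>0 nat) \<Rightarrow>\<^sub>0 'k::field) set \<Rightarrow> (nat \<Rightarrow>\<^sub>0 nat) \<Rightarrow>\<^sub>0 'k" where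
  "facet_hom F X = the_elem (face_hom (face_labelling F) (card F) ` X)"

context
  fixes n :: nat and \<Gamma> :: "nat set set"
  assumes \<Gamma>: "\<Gamma> \<in> simplicial_complexes n"
begin

lemma
  assumes F: "F \<in> \<Gamma>"
  shows facet_hom_residue: "f \<in> carrier (poly_ring n) \<Longrightarrow>
      facet_hom F (sr_residue n \<Gamma> f) = face_hom (face_labelling F) (card F) f"
    and hom_to_idom_facet_hom: "hom_to_idom (sr_ring n \<Gamma>) (facet_hom F)"
proof -
  note label = face_labelling[OF finite_complex(2)[OF \<Gamma> F]]
  note hom = hom_to_idom_face_hom[OF label(1), of n "card F"]
  have vanish: "face_hom (face_labelling F) (card F) g = 0" if "g \<in> sr_ideal n \<Gamma>" for g
    using that face_subset[OF \<Gamma> F]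
    unfolding face_hom_eq_0_iff[OF label(1)] label(2) sr_ideal_eq[OF \<Gamma>] by blast
  show "facet_hom F (sr_residue n \<Gamma> f) = face_hom (face_labelling F) (card F) f"
    if "f \<in> carrier (poly_ring n)"
    unfolding facet_hom_def sr_residue_def
    by (rule the_elem_image_coset[OF hom ideal_sr_ideal[OF \<Gamma>] vanish that])
  show "hom_to_idom (sr_ring n \<Gamma>) (facet_hom F)"
    unfolding facet_hom_def[abs_def] sr_ring_def
    by (rule hom_to_idom_quotient[OF hom ideal_sr_ideal[OF \<Gamma>] vanish])
qed

lemma carrier_sr_ring: "carrier (sr_ring n \<Gamma>) = sr_residue n \<Gamma> ` carrier (poly_ring n)"
  unfolding sr_ring_def FactRing_def A_RCOSETS_def' sr_residue_def by auto

lemma cring_sr_ring: "cring (sr_ring n \<Gamma>)"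
  unfolding sr_ring_def by (rule ideal.quotient_is_cring[OF ideal_sr_ideal[OF \<Gamma>] cring_poly_ring])

lemma facet_above:
  assumes "G \<in> \<Gamma>"
  shows "\<exists>F\<in>facets \<Gamma>. G \<subseteq> F"
proof -
  have "finite {F \<in> \<Gamma>. G \<subseteq> F}"
    using finite_complex(1)[OF \<Gamma>] by simp
  then obtain F where "F \<in> {F \<in> \<Gamma>. G \<subseteq> F}" "\<forall>H\<in>{F \<in> \<Gamma>. G \<subseteq> F}. F \<subseteq> H \<longrightarrow> F = H"
    using finite_has_maximal[of "{F \<in> \<Gamma>. G \<subseteq> F}"] assms by blast
  then show ?thesis
    unfolding facets_def by blast
qed

text \<open>A monomial that survives in the Stanley--Reisner ring is supported on a face, hence on a facet,
  and it survives in the polynomial ring of this facet.  The product of the variables of a facet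
  vanishes on every other facet, since facets do not contain each other.\<close>

lemma separated_homs_sr_ring:
  "separated_homs_to_idom (sr_ring n \<Gamma> :: ((nat \<Rightarrow>\<^sub>0 nat) \<Rightarrow>\<^sub>0 'k::field) set ring)
     (facets \<Gamma>) facet_hom (\<lambda>F. sr_residue n \<Gamma> (\<Prod>j\<in>F. poly_var j))"
proof (intro separated_homs_to_idom.intro separated_homs_to_idom_axioms.intro cring_sr_ring)
  have facet: "F \<in> \<Gamma>" "finite F" "F \<subseteq> {1..n}" if "F \<in> facets \<Gamma>" for F
  proof -
    show F: "F \<in> \<Gamma>" using that by (simp add: facets_def)
    then show "finite F" by (rule finite_complex(2)[OF \<Gamma>])
    show "F \<subseteq> {1..n}" using F \<Gamma> by (auto simp: simplicial_complexes_def)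
  qed
  have monomial: "(\<Prod>j\<in>F. poly_var j :: (nat \<Rightarrow>\<^sub>0 nat) \<Rightarrow>\<^sub>0 'k) \<in> carrier (poly_ring n)"
    "face_hom (face_labelling G) (card G) (\<Prod>j\<in>F. poly_var j :: (nat \<Rightarrow>\<^sub>0 nat) \<Rightarrow>\<^sub>0 'k) = 0 \<longleftrightarrow> \<not> F \<subseteq> G"
    if "F \<in> facets \<Gamma>" "G \<in> facets \<Gamma>" for F G
    using facet[OF that(1)] face_labelling[OF facet(2)[OF that(2)]]
    by (simp_all add: mem_poly_ring prod_poly_var keys_sum_single face_hom_eq_0_iff del: One_nat_def)
  fix F assume F: "F \<in> facets \<Gamma>"
  show "hom_to_idom (sr_ring n \<Gamma>) (facet_hom F :: _ \<Rightarrow> (nat \<Rightarrow>\<^sub>0 nat) \<Rightarrow>\<^sub>0 'k)"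
    by (rule hom_to_idom_facet_hom[OF facet(1)[OF F]])
  show "sr_residue n \<Gamma> (\<Prod>j\<in>F. poly_var j :: (nat \<Rightarrow>\<^sub>0 nat) \<Rightarrow>\<^sub>0 'k) \<in> carrier (sr_ring n \<Gamma>)"
    unfolding carrier_sr_ring using monomial(1)[OF F F] by blast
  show "facet_hom F (sr_residue n \<Gamma> (\<Prod>j\<in>F. poly_var j :: (nat \<Rightarrow>\<^sub>0 nat) \<Rightarrow>\<^sub>0 'k)) \<noteq> 0"
    using monomial[OF F F] by (simp add: facet_hom_residue facet(1)[OF F])
  fix G assume G: "G \<in> facets \<Gamma>" "F \<noteq> G"
  then have "\<not> F \<subseteq> G"
    using F by (auto simp: facets_def)
  then show "facet_hom G (sr_residue n \<Gamma> (\<Prod>j\<in>F. poly_var j :: (nat \<Rightarrow>\<^sub>0 nat) \<Rightarrow>\<^sub>0 'k)) = 0"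
    using monomial[OF F G(1)] by (simp add: facet_hom_residue facet(1)[OF G(1)])
next
  fix X :: "((nat \<Rightarrow>\<^sub>0 nat) \<Rightarrow>\<^sub>0 'k) set"
  assume "X \<in> carrier (sr_ring n \<Gamma>)" and vanish: "\<And>F. F \<in> facets \<Gamma> \<Longrightarrow> facet_hom F X = 0"
  then obtain f where f: "f \<in> carrier (poly_ring n)" "X = sr_residue n \<Gamma> f"
    unfolding carrier_sr_ring by blast
  have "Poly_Mapping.keys m \<notin> \<Gamma>" if m: "m \<in> Poly_Mapping.keys f" for m
  proof
    assume "Poly_Mapping.keys m \<in> \<Gamma>"
    then obtain F where F: "F \<in> facets \<Gamma>" "Poly_Mapping.keys m \<subseteq> F"
      using facet_above by blast
    then have "F \<in> \<Gamma>" by (simp add: facets_def)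
    note label = face_labelling[OF finite_complex(2)[OF \<Gamma> this]]
    have "face_hom (face_labelling F) (card F) f = 0"
      using vanish[OF F(1)] facet_hom_residue[OF \<open>F \<in> \<Gamma>\<close> f(1)] f(2) by simp
    then show False
      using m F(2) unfolding face_hom_eq_0_iff[OF label(1)] label(2) by blast
  qed
  then have "f \<in> sr_ideal n \<Gamma>"
    using f(1) by (simp add: sr_ideal_eq[OF \<Gamma>])
  then show "X = \<zero>\<^bsub>sr_ring n \<Gamma>\<^esub>"
    unfolding f(2) sr_residue_def sr_ring_def FactRing_def ring.simps
    by (rule ring.a_rcos_zero[OF cring.axioms(1)[OF cring_poly_ring] ideal_sr_ideal[OF \<Gamma>]])
qed

end

section \<open>The Hilbert function of a polynomial ring\<close>

lemma finite_lists_sum: "finite {l :: nat list. length l = k \<and> sum_list l = t}"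
proof (rule finite_subset)
  show "{l :: nat list. length l = k \<and> sum_list l = t} \<subseteq> {l. set l \<subseteq> {..t} \<and> length l = k}"
    using member_le_sum_list by fastforce
  show "finite {l :: nat list. set l \<subseteq> {..t} \<and> length l = k}"
    by (rule finite_lists_length_eq) simp
qed

definition monomials :: "nat \<Rightarrow> nat \<Rightarrow> (nat \<Rightarrow>\<^sub>0 nat) set" where
  "monomials k t = {m. Poly_Mapping.keys m \<subseteq> {1..k} \<and>
     (\<Sum>j\<in>Poly_Mapping.keys m. Poly_Mapping.lookup m j) = t}"

text \<open>Monomials of degree \<open>t\<close> in \<open>k\<close> variables are lists of \<open>k\<close> exponents with sum \<open>t\<close>.\<close>

lemma bij_betw_monomials:
  "bij_betw (\<lambda>m. map (Poly_Mapping.lookup m) [1..<Suc k]) (monomials k t)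
     {l. length l = k \<and> sum_list l = t}"
  (is "bij_betw ?f _ _")
proof (rule bij_betw_imageI)
  have supp: "Poly_Mapping.lookup m j = 0" if "Poly_Mapping.keys m \<subseteq> {1..k}" "j \<notin> {1..k}" for m :: "nat \<Rightarrow>\<^sub>0 nat" and j
    using that by (auto simp: in_keys_iff)
  show "inj_on ?f (monomials k t)"
  proof (rule inj_onI)
    fix m m' assume mm': "m \<in> monomials k t" "m' \<in> monomials k t" "?f m = ?f m'"
    have "Poly_Mapping.lookup m j = Poly_Mapping.lookup m' j" for j
    proof (cases "j \<in> {1..k}")
      case True
      then show ?thesis using mm'(3) unfolding map_eq_conv by auto
    next
      case False
      then show ?thesis using mm'(1,2) supp unfolding monomials_def by simp
    qed
    then show "m = m'" by (rule poly_mapping_eqI)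
  qed
  have sum: "sum_list (?f m) = (\<Sum>j\<in>Poly_Mapping.keys m. Poly_Mapping.lookup m j)"
    if "Poly_Mapping.keys m \<subseteq> {1..k}" for m :: "nat \<Rightarrow>\<^sub>0 nat"
  proof -
    have "sum_list (?f m) = (\<Sum>j\<in>{1..k}. Poly_Mapping.lookup m j)"
      by (simp add: sum_list_distinct_conv_sum_set atLeastLessThanSuc_atLeastAtMost del: upt_Suc)
    also have "\<dots> = (\<Sum>j\<in>Poly_Mapping.keys m. Poly_Mapping.lookup m j)"
      using that by (intro sum.mono_neutral_right) (auto simp: in_keys_iff)
    finally show ?thesis .
  qed
  show "?f ` monomials k t = {l. length l = k \<and> sum_list l = t}"
  proof (intro equalityI subsetI)
    fix l assume "l \<in> ?f ` monomials k t"
    then show "l \<in> {l. length l = k \<and> sum_list l = t}"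
      using sum unfolding monomials_def by (auto simp del: upt_Suc)
  next
    fix l :: "nat list" assume l: "l \<in> {l. length l = k \<and> sum_list l = t}"
    define m where "m = Poly_Mapping.Abs_poly_mapping (\<lambda>j. if j \<in> {1..k} then l ! (j - 1) else 0)"
    have lookup: "Poly_Mapping.lookup m j = (if j \<in> {1..k} then l ! (j - 1) else 0)" for j
      unfolding m_def by (subst lookup_Abs_poly_mapping) (auto intro: finite_subset[of _ "{1..k}"] split: if_splits)
    then have keys: "Poly_Mapping.keys m \<subseteq> {1..k}"
      by (auto simp: in_keys_iff split: if_splits)
    have f: "?f m = l"
      using l by (intro nth_equalityI) (auto simp: lookup simp del: upt_Suc)
    then have "m \<in> monomials k t"
      using keys sum[OF keys] l unfolding monomials_def by simp
    then show "l \<in> ?f ` monomials k t"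
      using f by blast
  qed
qed

lemma finite_monomials: "finite (monomials k t)"
  and card_monomials: "card (monomials k t) = (t + k - 1) choose t"
  using bij_betw_finite[OF bij_betw_monomials, of k t] bij_betw_same_card[OF bij_betw_monomials, of k t]
  by (simp_all add: finite_lists_sum card_length_sum_list)

text \<open>Adjoining a monomial extends the span by a line, so each one contributes \<open>1\<close> to the dimension.\<close>

lemma dimension_span_monomials:
  assumes "finite M" "\<And>m. m \<in> M \<Longrightarrow> Poly_Mapping.keys m \<subseteq> {1..k}"
  shows "ring.dimension (poly_ring k :: ((nat \<Rightarrow>\<^sub>0 nat) \<Rightarrow>\<^sub>0 'k::field) ring) (card M) poly_constants
    {f. Poly_Mapping.keys f \<subseteq> M}"
  using assms
proof (induction M rule: finite_induct)
  interpret cring "poly_ring k :: ((nat \<Rightarrow>\<^sub>0 nat) \<Rightarrow>\<^sub>0 'k) ring" by (rule cring_poly_ring)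
  case empty
  show ?case using zero_dim[of poly_constants] by simp
next
  interpret cring "poly_ring k :: ((nat \<Rightarrow>\<^sub>0 nat) \<Rightarrow>\<^sub>0 'k) ring" by (rule cring_poly_ring)
  case (insert m M)
  let ?m = "Poly_Mapping.single m 1 :: (nat \<Rightarrow>\<^sub>0 nat) \<Rightarrow>\<^sub>0 'k"
  let ?E = "\<lambda>M. {f :: (nat \<Rightarrow>\<^sub>0 nat) \<Rightarrow>\<^sub>0 'k. Poly_Mapping.keys f \<subseteq> M}"
  have "dimension (Suc (card M)) poly_constants (line_extension poly_constants ?m (?E M))"
  proof (rule Suc_dim)
    show "?m \<in> carrier (poly_ring k)"
      using insert.prems by (simp add: mem_poly_ring)
    show "?m \<notin> ?E M" using insert.hyps by simp
    show "dimension (card M) poly_constants (?E M)"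
      using insert.IH insert.prems by blast
  qed
  also have "line_extension poly_constants ?m (?E M) = ?E (insert m M)"
  proof (intro equalityI subsetI)
    fix f assume "f \<in> line_extension poly_constants ?m (?E M)"
    then obtain c g where "f = Poly_Mapping.single 0 c * ?m + g" "Poly_Mapping.keys g \<subseteq> M"
      unfolding line_extension_mem_iff poly_constants_def by auto
    then have "f = Poly_Mapping.single m c + g" "Poly_Mapping.keys g \<subseteq> M"
      by (simp_all add: mult_single)
    then show "f \<in> ?E (insert m M)"
      using keys_add[of "Poly_Mapping.single m c" g] by (auto split: if_splits)
  next
    fix f assume f: "f \<in> ?E (insert m M)"
    let ?c = "Poly_Mapping.lookup f m"
    let ?g = "f - Poly_Mapping.single m ?c"
    have "Poly_Mapping.keys ?g \<subseteq> M"
      using f by (auto simp: in_keys_iff lookup_minus lookup_single when_def split: if_splits)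
    moreover have "f = Poly_Mapping.single 0 ?c * ?m + ?g"
      by (simp add: mult_single)
    ultimately show "f \<in> line_extension poly_constants ?m (?E M)"
      unfolding line_extension_mem_iff poly_constants_def poly_ring_simps by blast
  qed
  finally show ?case
    using insert.hyps by simp
qed

lemma dimension_homogeneous_polys:
  "ring.dimension (poly_ring k :: ((nat \<Rightarrow>\<^sub>0 nat) \<Rightarrow>\<^sub>0 'k::field) ring) ((t + k - 1) choose t)
     poly_constants (homogeneous_polys k t)"
proof -
  have "homogeneous_polys k t = {f :: (nat \<Rightarrow>\<^sub>0 nat) \<Rightarrow>\<^sub>0 'k. Poly_Mapping.keys f \<subseteq> monomials k t}"
    by (auto simp: homogeneous_polys_def monomials_def mem_poly_ring)
  moreover have "Poly_Mapping.keys m \<subseteq> {1..k}" if "m \<in> monomials k t" for m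
    using that by (simp add: monomials_def)
  ultimately show ?thesis
    using dimension_span_monomials[OF finite_monomials, of k t k] unfolding card_monomials by metis
qed

text \<open>Induction by the recurrence
  \<open>(j + 1) (t + j + 1 choose j + 1) = (t + j + 1) (t + j choose j)\<close>; each step multiplies by a
  linear polynomial in \<open>t\<close> with positive leading coefficient.\<close>

lemma binomial_is_polynomial:
  "\<exists>p :: rat poly. lead_coeff p > 0 \<and> (\<forall>t. poly p (of_nat t) = of_nat ((t + j) choose j))"
proof (induction j)
  case 0
  show ?case by (rule exI[of _ 1]) simp
next
  case (Suc j)
  then obtain p :: "rat poly"
    where p: "lead_coeff p > 0" "\<And>t. poly p (of_nat t) = of_nat ((t + j) choose j)" by blast
  let ?p = "smult (1 / of_nat (Suc j)) ([:of_nat (Suc j), 1:] * p)"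
  have "poly ?p (of_nat t) = of_nat ((t + Suc j) choose Suc j)" for t
  proof -
    have "of_nat (Suc j) * (of_nat ((t + Suc j) choose Suc j) :: rat) =
        of_nat (Suc (t + j)) * of_nat ((t + j) choose j)"
      using Suc_times_binomial_eq[of "t + j" j] unfolding of_nat_mult[symmetric] by (simp add: mult.commute)
    moreover have "(of_nat (Suc j) :: rat) \<noteq> 0"
      by (rule of_nat_neq_0)
    ultimately have "of_nat ((t + Suc j) choose Suc j) =
        (1 / of_nat (Suc j)) * ((of_nat (Suc (t + j)) :: rat) * of_nat ((t + j) choose j))"
      by (simp add: field_simps del: of_nat_Suc)
    then show ?thesis
      by (simp add: p(2) algebra_simps)
  qed
  moreover have "lead_coeff ?p > 0"
    using p(1) by (simp only: lead_coeff_smult lead_coeff_mult) simp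
  ultimately show ?case by blast
qed

text \<open>The Hilbert polynomial is a definite description.  It denotes \<open>q\<close> because two polynomials that
  agree at almost all natural numbers are equal.\<close>

lemma lead_coeff_eventual_polynomial_nonneg:
  fixes q :: "rat poly"
  assumes "\<forall>\<^sub>F t in sequentially. of_nat (H t) = poly q (of_nat t)" "lead_coeff q \<ge> 0"
  shows "lead_coeff (THE p :: rat poly. \<forall>\<^sub>F t in sequentially. of_nat (H t) = poly p (of_nat t)) \<ge> 0"
proof -
  have "p = q" if p: "\<forall>\<^sub>F t in sequentially. of_nat (H t) = poly p (of_nat t)" for p
  proof (rule ccontr)
    assume "p \<noteq> q"
    then have fin: "finite {x. poly (p - q) x = 0}"
      by (intro poly_roots_finite) simp
    have "\<forall>\<^sub>F t in sequentially. poly (p - q) (of_nat t) = 0"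
      using p assms(1) by eventually_elim simp
    then obtain N where N: "\<And>t. t \<ge> N \<Longrightarrow> poly (p - q) (of_nat t) = 0"
      by (auto simp: eventually_sequentially)
    have "(of_nat :: nat \<Rightarrow> rat) ` {N..} \<subseteq> {x. poly (p - q) x = 0}"
      using N by blast
    from finite_subset[OF this fin] show False
      by (simp add: finite_image_iff inj_on_def infinite_Ici)
  qed
  then have "(THE p :: rat poly. \<forall>\<^sub>F t in sequentially. of_nat (H t) = poly p (of_nat t)) = q"
    using assms(1) by (intro the_equality)
  then show ?thesis using assms(2) by simp
qed

lemma graded_multiplicity_poly_ring_nonneg:
  "graded_multiplicity (poly_ring k :: ((nat \<Rightarrow>\<^sub>0 nat) \<Rightarrow>\<^sub>0 'k::field) ring) poly_constants
     (homogeneous_polys k) \<ge> 0"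
proof -
  let ?A = "poly_ring k :: ((nat \<Rightarrow>\<^sub>0 nat) \<Rightarrow>\<^sub>0 'k) ring"
  interpret cring ?A by (rule cring_poly_ring)
  have dim: "dim poly_constants (homogeneous_polys k t) = (t + k - 1) choose t" for t
    using dimI[OF subfield_poly_constants dimension_homogeneous_polys] by (simp add: over_def)
  obtain q :: "rat poly"
    where "\<forall>\<^sub>F t in sequentially. of_nat ((t + k - 1) choose t) = poly q (of_nat t)" "lead_coeff q \<ge> 0"
  proof (cases k)
    case 0
    \<comment> \<open>Without variables there are no monomials of positive degree.\<close>
    have "\<forall>\<^sub>F t in sequentially. of_nat ((t + k - 1) choose t) = poly (0 :: rat poly) (of_nat t)"
      using eventually_gt_at_top[of 0] by eventually_elim (simp add: 0 binomial_eq_0)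
    then show thesis by (rule that) simp
  next
    case (Suc j)
    obtain p :: "rat poly"
      where p: "lead_coeff p > 0" "\<And>t. poly p (of_nat t) = of_nat ((t + j) choose j)"
      using binomial_is_polynomial by blast
    have "(t + k - 1) choose t = (t + j) choose j" for t
      using binomial_symmetric[of t "t + j"] by (simp add: Suc)
    then show thesis
      using that[of p] p by simp
  qed
  then have "lead_coeff (hilbert_polynomial ?A poly_constants (homogeneous_polys k)) \<ge> 0"
    unfolding hilbert_polynomial_def dim by (rule lead_coeff_eventual_polynomial_nonneg)
  then show ?thesis
    by (simp add: graded_multiplicity_def)
qed

section \<open>The arithmetic degree as a weighted number of facets\<close>

text \<open>The contribution to \<open>adeg\<^sub>i\<close> of a facet with \<open>k\<close> elements.\<close>

definition adeg_weight :: "'k::field itself \<Rightarrow> nat \<Rightarrow> nat \<Rightarrow> rat" where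
  "adeg_weight _ i k =
     (if krull_dim (poly_ring k :: ((nat \<Rightarrow>\<^sub>0 nat) \<Rightarrow>\<^sub>0 'k) ring) = enat i
      then graded_multiplicity (poly_ring k :: ((nat \<Rightarrow>\<^sub>0 nat) \<Rightarrow>\<^sub>0 'k) ring)
        poly_constants (homogeneous_polys k)
      else 0)"

lemma adeg_weight_nonneg: "adeg_weight TYPE('k::field) i k \<ge> 0"
  by (simp add: adeg_weight_def graded_multiplicity_poly_ring_nonneg)

context
  fixes n :: nat and \<Gamma> :: "nat set set"
  assumes \<Gamma>: "\<Gamma> \<in> simplicial_complexes n"
begin

lemma
  fixes F :: "nat set"
  defines "P \<equiv> hom_to_idom.ker (sr_ring n \<Gamma>) (facet_hom F :: _ \<Rightarrow> (nat \<Rightarrow>\<^sub>0 nat) \<Rightarrow>\<^sub>0 'k::field)"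
  assumes F: "F \<in> \<Gamma>"
  shows krull_dim_component: "krull_dim (sr_ring n \<Gamma> Quot P) =
      krull_dim (poly_ring (card F) :: ((nat \<Rightarrow>\<^sub>0 nat) \<Rightarrow>\<^sub>0 'k) ring)"
    and graded_multiplicity_component: "graded_multiplicity (sr_ring n \<Gamma> Quot P)
        ((\<lambda>x. P +>\<^bsub>sr_ring n \<Gamma>\<^esub> x) ` sr_residue n \<Gamma> ` poly_constants)
        (\<lambda>t. (\<lambda>x. P +>\<^bsub>sr_ring n \<Gamma>\<^esub> x) ` sr_residue n \<Gamma> ` homogeneous_polys n t) =
      graded_multiplicity (poly_ring (card F) :: ((nat \<Rightarrow>\<^sub>0 nat) \<Rightarrow>\<^sub>0 'k) ring)
        poly_constants (homogeneous_polys (card F))"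
proof -
  let ?k = "card F"
  let ?R = "sr_ring n \<Gamma> :: ((nat \<Rightarrow>\<^sub>0 nat) \<Rightarrow>\<^sub>0 'k) set ring"
  let ?A = "poly_ring ?k :: ((nat \<Rightarrow>\<^sub>0 nat) \<Rightarrow>\<^sub>0 'k) ring"
  let ?h = "facet_hom F :: _ \<Rightarrow> (nat \<Rightarrow>\<^sub>0 nat) \<Rightarrow>\<^sub>0 'k"
  note label = face_labelling[OF finite_complex(2)[OF \<Gamma> F]]
  have "F \<subseteq> {1..n}" using F \<Gamma> by (auto simp: simplicial_complexes_def)
  then have vertices: "face_labelling F -` {1..?k} \<subseteq> {1..n}" by (simp only: label(2))
  note lift = face_hom_section[OF label(1) vertices]
  interpret hom_to_idom ?R ?h by (rule hom_to_idom_facet_hom[OF \<Gamma> F])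
  have h_residue: "?h ` sr_residue n \<Gamma> ` A = face_hom (face_labelling F) ?k ` A"
    if "A \<subseteq> carrier (poly_ring n)" for A
    unfolding image_image using that facet_hom_residue[OF \<Gamma> F] by (intro image_cong) auto
  have homogeneous_sub: "homogeneous_polys m t \<subseteq> (carrier (poly_ring m) :: ((nat \<Rightarrow>\<^sub>0 nat) \<Rightarrow>\<^sub>0 'k) set)" for m t
    by (auto simp: homogeneous_polys_def)
  have constants_sub: "(poly_constants :: ((nat \<Rightarrow>\<^sub>0 nat) \<Rightarrow>\<^sub>0 'k) set) \<subseteq> carrier (poly_ring n)"
    by (auto simp: poly_constants_def constant_in_poly_ring)
  have surj: "?h ` carrier ?R = carrier ?A"
    unfolding carrier_sr_ring[OF \<Gamma>] h_residue[OF order_refl]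
    using face_hom_closed[OF label(1)] lift by blast
  have hom: "ring_hom_ring ?R ?A ?h"
    by (rule ring_hom_ringI)
      (use surj in \<open>auto simp: ring_axioms cring.axioms(1)[OF cring_poly_ring] hom_add hom_mult hom_one\<close>)
  have ker: "P = a_kernel ?R ?A ?h"
    by (simp add: P_def ker_def a_kernel_def')
  have constants: "?h ` sr_residue n \<Gamma> ` poly_constants = poly_constants"
    unfolding h_residue[OF constants_sub]
    by (simp add: poly_constants_def image_image face_hom_constant[OF label(1)])
  have homogeneous: "?h ` sr_residue n \<Gamma> ` homogeneous_polys n t = homogeneous_polys ?k t" for t
    unfolding h_residue[OF homogeneous_sub]
  proof (intro equalityI subsetI)
    show "g \<in> homogeneous_polys ?k t"
      if "g \<in> face_hom (face_labelling F) ?k ` homogeneous_polys n t" for g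
      using that face_hom_homogeneous[OF label(1)] by blast
    show "g \<in> face_hom (face_labelling F) ?k ` homogeneous_polys n t"
      if "g \<in> homogeneous_polys ?k t" for g :: "(nat \<Rightarrow>\<^sub>0 nat) \<Rightarrow>\<^sub>0 'k"
      using lift[of g] that homogeneous_sub by blast
  qed
  show "krull_dim (?R Quot P) = krull_dim ?A"
    unfolding ker by (rule krull_dim_quotient_kernel[OF hom is_cring cring_poly_ring surj])
  have "graded_multiplicity (?R Quot P)
      ((\<lambda>x. P +>\<^bsub>?R\<^esub> x) ` sr_residue n \<Gamma> ` poly_constants)
      (\<lambda>t. (\<lambda>x. P +>\<^bsub>?R\<^esub> x) ` sr_residue n \<Gamma> ` homogeneous_polys n t) =
    graded_multiplicity ?A (?h ` sr_residue n \<Gamma> ` poly_constants)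
      (\<lambda>t. ?h ` sr_residue n \<Gamma> ` homogeneous_polys n t)"
    unfolding ker
  proof (rule graded_multiplicity_quotient_kernel[OF hom is_cring cring_poly_ring surj])
    show "sr_residue n \<Gamma> ` poly_constants \<subseteq> carrier ?R"
      unfolding carrier_sr_ring[OF \<Gamma>] by (rule image_mono[OF constants_sub])
    show "sr_residue n \<Gamma> ` homogeneous_polys n t \<subseteq> carrier ?R" for t
      unfolding carrier_sr_ring[OF \<Gamma>] by (rule image_mono[OF homogeneous_sub])
    show "subfield (?h ` sr_residue n \<Gamma> ` poly_constants) ?A"
      unfolding constants by (rule subfield_poly_constants)
    show "\<exists>r. ring.dimension ?A r (?h ` sr_residue n \<Gamma> ` poly_constants)
        (?h ` sr_residue n \<Gamma> ` homogeneous_polys n t)" for t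
      unfolding constants homogeneous using dimension_homogeneous_polys by blast
  qed
  then show "graded_multiplicity (?R Quot P)
      ((\<lambda>x. P +>\<^bsub>?R\<^esub> x) ` sr_residue n \<Gamma> ` poly_constants)
      (\<lambda>t. (\<lambda>x. P +>\<^bsub>?R\<^esub> x) ` sr_residue n \<Gamma> ` homogeneous_polys n t) =
    graded_multiplicity ?A poly_constants (homogeneous_polys ?k)"
    by (simp only: constants homogeneous)
qed

text \<open>The associated primes of the Stanley--Reisner ring are the kernels of the projections to the
  facets, and the residue ring at a facet depends on the number of its vertices only.\<close>

lemma complex_adeg_eq:
  "complex_adeg TYPE('k::field) n \<Gamma> i = (\<Sum>F\<in>facets \<Gamma>. adeg_weight TYPE('k) i (card F))"
proof -
  let ?R = "sr_ring n \<Gamma> :: ((nat \<Rightarrow>\<^sub>0 nat) \<Rightarrow>\<^sub>0 'k) set ring"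
  let ?P = "\<lambda>F. hom_to_idom.ker ?R (facet_hom F :: _ \<Rightarrow> (nat \<Rightarrow>\<^sub>0 nat) \<Rightarrow>\<^sub>0 'k)"
  have face: "F \<in> \<Gamma>" if "F \<in> facets \<Gamma>" for F
    using that by (simp add: facets_def)
  have fin: "finite (facets \<Gamma>)"
    by (rule finite_subset[OF _ finite_complex(1)[OF \<Gamma>]]) (auto simp: facets_def)
  have "complex_adeg TYPE('k) n \<Gamma> i =
      (\<Sum>F\<in>{F \<in> facets \<Gamma>. krull_dim (?R Quot ?P F) = enat i}.
        graded_multiplicity (?R Quot ?P F)
          ((\<lambda>x. ?P F +>\<^bsub>?R\<^esub> x) ` sr_residue n \<Gamma> ` poly_constants)
          (\<lambda>t. (\<lambda>x. ?P F +>\<^bsub>?R\<^esub> x) ` sr_residue n \<Gamma> ` homogeneous_polys n t))"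
    unfolding complex_adeg_def
    by (rule separated_homs_to_idom.ring_adeg_eq[OF separated_homs_sr_ring[OF \<Gamma>]])
  also have "\<dots> = (\<Sum>F\<in>{F \<in> facets \<Gamma>. krull_dim (?R Quot ?P F) = enat i}. adeg_weight TYPE('k) i (card F))"
  proof (rule sum.cong)
    fix F assume "F \<in> {F \<in> facets \<Gamma>. krull_dim (?R Quot ?P F) = enat i}"
    then have F: "F \<in> \<Gamma>" and dim: "krull_dim (?R Quot ?P F) = enat i"
      using face by blast+
    show "graded_multiplicity (?R Quot ?P F)
          ((\<lambda>x. ?P F +>\<^bsub>?R\<^esub> x) ` sr_residue n \<Gamma> ` poly_constants)
          (\<lambda>t. (\<lambda>x. ?P F +>\<^bsub>?R\<^esub> x) ` sr_residue n \<Gamma> ` homogeneous_polys n t) =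
        adeg_weight TYPE('k) i (card F)"
      using dim unfolding graded_multiplicity_component[OF F] krull_dim_component[OF F] adeg_weight_def
      by simp
  qed simp
  also have "\<dots> = (\<Sum>F\<in>facets \<Gamma>. adeg_weight TYPE('k) i (card F))"
  proof (rule sum.mono_neutral_left[OF fin])
    show "\<forall>F\<in>facets \<Gamma> - {F \<in> facets \<Gamma>. krull_dim (?R Quot ?P F) = enat i}.
        adeg_weight TYPE('k) i (card F) = 0"
    proof
      fix F assume "F \<in> facets \<Gamma> - {F \<in> facets \<Gamma>. krull_dim (?R Quot ?P F) = enat i}"
      then have F: "F \<in> \<Gamma>" and dim: "krull_dim (?R Quot ?P F) \<noteq> enat i"
        using face by blast+
      show "adeg_weight TYPE('k) i (card F) = 0"
        using dim unfolding krull_dim_component[OF F] adeg_weight_def by simp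
    qed
  qed blast
  finally show ?thesis .
qed

end

theorem theorem4p1:
  fixes n d :: nat
    and \<Delta> :: "nat set set \<Rightarrow> nat set set"
    and \<Gamma> :: "nat set set"
  assumes "shifting_operation n \<Delta>"
    and "\<Gamma> \<in> simplicial_complexes n"
    and "complex_dim \<Gamma> = int d - 1"
  shows "(\<forall>i\<in>{0..d}. complex_adeg TYPE('k::field) n \<Gamma> i
                     \<le> complex_adeg TYPE('k) n (\<Delta> \<Gamma>) i)
         \<and> card (facets \<Gamma>) \<le> card (facets (\<Delta> \<Gamma>))"
proof -
  have \<Delta>\<Gamma>: "\<Delta> \<Gamma> \<in> simplicial_complexes n"
    by (rule bspec[OF conjunct1[OF assms(1)[unfolded shifting_operation_def]] assms(2)])
  \<comment> \<open>Sort the facets by cardinality: in each cardinality their number does not decrease.\<close>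
  have mono: "(\<Sum>F\<in>facets \<Gamma>. w (card F)) \<le> (\<Sum>F\<in>facets (\<Delta> \<Gamma>). w (card F))"
    if "\<And>k. 0 \<le> w k" for w :: "nat \<Rightarrow> rat"
    unfolding sum_over_facets[OF assms(2)] sum_over_facets[OF \<Delta>\<Gamma>]
    by (intro sum_mono mult_right_mono of_nat_mono card_facets_le_shifting[OF assms(1,2)] that)
  have "complex_adeg TYPE('k) n \<Gamma> i \<le> complex_adeg TYPE('k) n (\<Delta> \<Gamma>) i" for i
    unfolding complex_adeg_eq[OF assms(2)] complex_adeg_eq[OF \<Delta>\<Gamma>]
    by (rule mono[OF adeg_weight_nonneg])
  moreover have "card (facets \<Gamma>) \<le> card (facets (\<Delta> \<Gamma>))"
    using mono[of "\<lambda>_. 1"] by simp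
  ultimately show ?thesis by simp
qed

end
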